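(* Let $(g(n))_{n\ge 1}$ be an additive function with values in the set of natural numbers such that $g(q)=1$ for every prime number $q$. Assume moreover that there exists $\beta>0$ such that for every integer $m\ge 1$ and every prime number $q$, $$g(q^m)\le \beta\, m\log q .$$ Then, for every real $p>1$, $(g(n))_{n\ge 1}$ is a good weight for both the dominated ergodic theorem in $L^p$ and the pointwise ergodic theorem in $L^p$.
   Context: An arithmetic function $g$ is additive if $g(mn)=g(m)+g(n)$ whenever $m,n\ge1$ are coprime. Natural numbers include $0$ here (an additive function has $g(1)=0$). A dynamical system $(X,\mathcal A,\nu,\tau)$ is a probability space $(X,\mathcal A,\nu)$ with a measurable transformation $\tau:X\to X$ preserving $\nu$. For a sequence of real numbers $(w_k)_{k\ge 1}$ put $W_n=\sum_{k=1}^n|w_k|$; it is assumed that $W_n\to\infty$, and the quotients below are taken to be $0$ for those (finitely many) $n$ with $W_n=0$. The sequence $(w_k)_{k\ge1}$ is a good weight for the dominated ergodic theorem in $L^p$, $p>1$, if there exists $C_p>0$ such that for every dynamical system $(X,\mathcal A,\nu,\tau)$ and every $f\in L^p(\nu)$, $$\Big\|\sup_{n\ge 1}\frac{|\sum_{1\le k\le n} w_k f\circ\tau^k|}{W_n}\Big\|_p\le C_p\|f\|_p .$$ It is a good weight for the pointwise ergodic theorem in $L^p$ if for every dynamical system $(X,\mathcal A,\nu,\tau)$ and every $f\in L^p(\nu)$ the sequence $\big(\frac1{W_n}\sum_{1\le k\le n} w_k f\circ\tau^k\big)_n$ converges $\nu$-a.s. *)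

theory Defs
  imports "HOL-Probability.Probability" "HOL-Computational_Algebra.Primes"
begin

definition additive_function :: "(nat \<Rightarrow> 'b::monoid_add) \<Rightarrow> bool" where
  "additive_function g \<longleftrightarrow>
     (\<forall>m\<ge>1. \<forall>n\<ge>1. coprime m n \<longrightarrow> g (m * n) = g m + g n)"

locale dynamical_system = prob_space M for M :: "'a measure" and \<tau> :: "'a \<Rightarrow> 'a" +
  assumes measurable_map: "\<tau> \<in> measurable M M"
    and preserves_measure: "distr M M \<tau> = M"

text \<open>Only used for positive exponents, where \<open>\<infinity>\<close> raised to \<open>r\<close> is \<open>\<infinity>\<close>.\<close>
definition ennreal_powr :: "ennreal \<Rightarrow> real \<Rightarrow> ennreal" where
  "ennreal_powr x r = (if x = \<infinity> then \<infinity> else ennreal (enn2real x powr r))"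

text \<open>
  The \<open>L\<^sup>p\<close> norm of an extended nonnegative function; it may be infinite, which is needed
  because a maximal function takes values in \<open>[0, \<infinity>]\<close>.
\<close>
definition Lp_enorm :: "real \<Rightarrow> 'a measure \<Rightarrow> ('a \<Rightarrow> ennreal) \<Rightarrow> ennreal" where
  "Lp_enorm p M h = ennreal_powr (\<integral>\<^sup>+ x. ennreal_powr (h x) p \<partial>M) (1 / p)"

definition Lp_norm :: "real \<Rightarrow> 'a measure \<Rightarrow> ('a \<Rightarrow> complex) \<Rightarrow> ennreal" where
  "Lp_norm p M f = Lp_enorm p M (\<lambda>x. ennreal (cmod (f x)))"

text \<open>Complex-valued functions; real-valued ones are included via \<^const>\<open>complex_of_real\<close>.\<close>
definition Lp_space :: "real \<Rightarrow> 'a measure \<Rightarrow> ('a \<Rightarrow> complex) set" where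
  "Lp_space p M = {f \<in> borel_measurable M. Lp_norm p M f < \<infinity>}"

definition total_weight :: "(nat \<Rightarrow> real) \<Rightarrow> nat \<Rightarrow> real" where
  "total_weight w n = (\<Sum>k=1..n. \<bar>w k\<bar>)"

text \<open>Since \<open>x / 0 = 0\<close>, the average is \<open>0\<close> whenever the total weight vanishes.\<close>
definition weighted_average ::
    "(nat \<Rightarrow> real) \<Rightarrow> ('a \<Rightarrow> 'a) \<Rightarrow> ('a \<Rightarrow> complex) \<Rightarrow> nat \<Rightarrow> 'a \<Rightarrow> complex" where
  "weighted_average w \<tau> f n x =
     (\<Sum>k=1..n. complex_of_real (w k) * f ((\<tau> ^^ k) x)) / complex_of_real (total_weight w n)"

definition maximal_function ::
    "(nat \<Rightarrow> real) \<Rightarrow> ('a \<Rightarrow> 'a) \<Rightarrow> ('a \<Rightarrow> complex) \<Rightarrow> 'a \<Rightarrow> ennreal" where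
  "maximal_function w \<tau> f x = (SUP n\<in>{1..}. ennreal (cmod (weighted_average w \<tau> f n x)))"

text \<open>
  The dominated inequality with constant \<open>C\<close>, for all dynamical systems whose underlying set
  is a set of elements of type \<open>'a\<close>.
\<close>
definition dominated_with ::
    "'a itself \<Rightarrow> (nat \<Rightarrow> real) \<Rightarrow> real \<Rightarrow> real \<Rightarrow> bool" where
  "dominated_with _ w p C \<longleftrightarrow>
     (\<forall>(M :: 'a measure) \<tau>. dynamical_system M \<tau> \<longrightarrow>
        (\<forall>f \<in> Lp_space p M. Lp_enorm p M (maximal_function w \<tau> f) \<le> ennreal C * Lp_norm p M f))"

text \<open>
  A constant that serves every dynamical system must not depend on the type carrying the system,
  but HOL cannot quantify over types below an existential quantifier. A plain
  \<open>\<exists>C>0. dominated_with TYPE('a) w p C\<close> would let \<open>C\<close> vary with \<open>'a\<close>. Hence one type is fixed on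
  which a constant is required to exist (sequences, since the orbit map sending \<open>x\<close> to
  \<open>(f (\<tau>\<^sup>k x))\<^sub>k\<close> makes a shift on sequences a factor of any system), and every constant
  valid there is required to be valid on \<open>'a\<close>. For \<open>'a\<close> arbitrary this gives a single \<open>C\<close>
  valid for all dynamical systems on all types.
\<close>
definition good_weight_dominated :: "'a itself \<Rightarrow> (nat \<Rightarrow> real) \<Rightarrow> real \<Rightarrow> bool" where
  "good_weight_dominated _ w p \<longleftrightarrow>
     filterlim (total_weight w) at_top sequentially \<and>
     (\<exists>C>0. dominated_with TYPE(nat \<Rightarrow> complex) w p C) \<and>
     (\<forall>C>0. dominated_with TYPE(nat \<Rightarrow> complex) w p C \<longrightarrow> dominated_with TYPE('a) w p C)"

definition good_weight_pointwise :: "'a itself \<Rightarrow> (nat \<Rightarrow> real) \<Rightarrow> real \<Rightarrow> bool" where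
  "good_weight_pointwise _ w p \<longleftrightarrow>
     filterlim (total_weight w) at_top sequentially \<and>
     (\<forall>(M :: 'a measure) \<tau>. dynamical_system M \<tau> \<longrightarrow>
        (\<forall>f \<in> Lp_space p M. AE x in M. convergent (\<lambda>n. weighted_average w \<tau> f n x)))"

end

theory Submission
  imports Defs "HOL-Real_Asymp.Real_Asymp"
begin

text \<open>
  The weights \<open>g\<close> are concentrated near their mean. Let \<open>\<omega>(k)\<close> be the number of prime divisors of
  \<open>k\<close> and \<open>L\<^sub>n\<close> the sum of the reciprocals of the primes up to \<open>n\<close>, so that \<open>L\<^sub>n \<rightarrow> \<infinity>\<close>
  (\<open>prime_reciprocals_at_top\<close>). Turan's variance estimate gives
  \<open>\<Sum>\<^sub>k\<^sub>\<le>\<^sub>n |\<omega>(k) - L\<^sub>n| = O(n L\<^sub>n\<^sup>1\<^sup>/\<^sup>2)\<close>, and counting multiples of primes gives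
  \<open>\<Sum>\<^sub>k\<^sub>\<le>\<^sub>n \<omega>(k)\<^sup>r = O(n (1 + L\<^sub>n)\<^sup>r)\<close> for every \<open>r\<close>. Only prime powers with exponent at least \<open>2\<close> make
  \<open>g\<close> differ from \<open>\<omega>\<close>, and by the growth hypothesis the difference at \<open>k\<close> is at most a constant
  times \<open>ln a\<close> for some square \<open>a\<^sup>2\<close> dividing \<open>k\<close>; since multiples of large squares are rare, all
  moments of the difference are \<open>O(n)\<close>. Hence \<open>W\<^sub>n\<close> is of order \<open>n L\<^sub>n\<close>, and \<open>g\<close> satisfies
  \<open>\<Sum>\<^sub>k\<^sub>\<le>\<^sub>n g(k)\<^sup>r = O(n (W\<^sub>n / n)\<^sup>r)\<close> and \<open>\<Sum>\<^sub>k\<^sub>\<le>\<^sub>n |g(k) - L\<^sub>n| = o(W\<^sub>n)\<close>.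

  These two properties suffice for any nonnegative weight with \<open>W\<^sub>n \<rightarrow> \<infinity>\<close> (\<open>good_weight_criterion\<close>).
  The first one and Hoelder's inequality bound the weighted averages of \<open>f\<close> by a constant times \<open>(M |f|\<^sup>s)\<^sup>1\<^sup>/\<^sup>s\<close>, where \<open>M\<close> is the
  unweighted ergodic maximal operator and \<open>s\<close> the exponent conjugate to \<open>r\<close>. For large \<open>r\<close> we have
  \<open>s < p\<close>, and the dominated ergodic theorem in \<open>L\<^sup>p\<^sup>/\<^sup>s\<close> applies. The second one shows that for
  bounded \<open>f\<close> the weighted averages behave like the unweighted ones, which converge by Birkhoff's
  theorem; bounded functions are dense, so the maximal inequality extends convergence to \<open>L\<^sup>p\<close>.

  The ergodic theorems are proved along the classical route: Hopf's maximal inequality gives both the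
  weak-type inequality, hence by Marcinkiewicz's truncation the strong one, and Birkhoff's theorem.
  Finally, a dominated inequality for shifts on sequences passes to an arbitrary system along the
  orbit map, with the same constant (\<open>dominated_with_transfer\<close>).
\<close>

section \<open>Prime divisors of an integer\<close>

definition omega :: "nat \<Rightarrow> nat" where
  "omega k = card (prime_factors k)"

definition prime_reciprocals :: "nat \<Rightarrow> real" where
  "prime_reciprocals n = (\<Sum>q | prime q \<and> q \<le> n. 1 / real q)"

lemma prime_reciprocals_nonneg: "0 \<le> prime_reciprocals n"
  unfolding prime_reciprocals_def by (rule sum_nonneg) simp

lemma prime_reciprocals_mono: "m \<le> n \<Longrightarrow> prime_reciprocals m \<le> prime_reciprocals n"
  unfolding prime_reciprocals_def by (rule sum_mono2) auto

lemma sum_multiples: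
  fixes F :: "nat \<Rightarrow> 'b::comm_monoid_add"
  assumes "d > 0"
  shows "(\<Sum>k | k \<in> {1..N} \<and> d dvd k. F k) = (\<Sum>j=1..N div d. F (d * j))"
proof (rule sum.reindex_bij_witness[of _ "\<lambda>j. d * j" "\<lambda>k. k div d"])
  fix k assume "k \<in> {k. k \<in> {1..N} \<and> d dvd k}"
  then show "d * (k div d) = k" "k div d \<in> {1..N div d}" "F (d * (k div d)) = F k"
    using assms by (auto simp: div_le_mono dvd_imp_le div_greater_zero_iff Suc_le_eq)
next
  fix j assume j: "j \<in> {1..N div d}"
  then have "d * j \<le> d * (N div d)" by simp
  also have "\<dots> \<le> N" by simp
  finally show "d * j \<in> {k. k \<in> {1..N} \<and> d dvd k}" "d * j div d = j"
    using assms j by auto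
qed

text \<open>
  Every \<open>k\<close> is counted once for each of its prime divisors \<open>q\<close>, as the multiple \<open>k = q j\<close> of \<open>q\<close>.
\<close>
lemma sum_omega_mult:
  "(\<Sum>k=1..N. real (omega k) * F k) =
     (\<Sum>q | prime q \<and> q \<le> N. \<Sum>j=1..N div q. F (q * j))"
proof -
  have "(\<Sum>k=1..N. real (omega k) * F k) =
      (\<Sum>k=1..N. \<Sum>q | q \<in> {q. prime q \<and> q \<le> N} \<and> q dvd k. F k)"
  proof (rule sum.cong[OF refl])
    fix k assume k: "k \<in> {1..N}"
    have "prime_factors k = {q \<in> {q. prime q \<and> q \<le> N}. q dvd k}"
      using k by (auto simp: prime_factors_dvd dest: dvd_imp_le)
    then show "real (omega k) * F k = (\<Sum>q | q \<in> {q. prime q \<and> q \<le> N} \<and> q dvd k. F k)"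
      by (simp add: omega_def)
  qed
  also have "\<dots> = (\<Sum>q\<in>{q. prime q \<and> q \<le> N}. \<Sum>k | k \<in> {1..N} \<and> q dvd k. F k)"
    by (rule sum.swap_restrict) auto
  also have "\<dots> = (\<Sum>q | prime q \<and> q \<le> N. \<Sum>j=1..N div q. F (q * j))"
    by (intro sum.cong refl sum_multiples) (auto simp: prime_gt_0_nat)
  finally show ?thesis .
qed

lemma omega_prime_mult_le:
  assumes "prime q" "j \<ge> 1"
  shows "omega (q * j) \<le> 1 + omega j"
proof -
  have "prime_factors (q * j) = insert q (prime_factors j)"
    using assms by (auto simp: prime_factors_product prime_factorization_prime)
  then show ?thesis
    by (simp add: omega_def card_insert_if)
qed

text \<open>
  A factor \<open>\<omega>(k)\<close> costs at most a factor \<open>L\<^sub>n\<close>: the multiples of \<open>q\<close> up to \<open>N\<close> contribute at most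
  \<open>B N / q\<close>, because passing from \<open>j\<close> to \<open>q j\<close> raises \<open>\<omega>\<close> by at most one.
\<close>
lemma sum_omega_mult_le:
  assumes mono: "mono F" and Nn: "N \<le> n"
    and bd: "\<And>M. M \<le> n \<Longrightarrow> (\<Sum>j=1..M. F (Suc (omega j))) \<le> B * real M" and B: "B \<ge> 0"
  shows "(\<Sum>k=1..N. real (omega k) * F (omega k)) \<le> B * real N * prime_reciprocals n"
proof -
  have "(\<Sum>k=1..N. real (omega k) * F (omega k)) =
      (\<Sum>q | prime q \<and> q \<le> N. \<Sum>j=1..N div q. F (omega (q * j)))"
    by (rule sum_omega_mult)
  also have "\<dots> \<le> (\<Sum>q | prime q \<and> q \<le> N. \<Sum>j=1..N div q. F (Suc (omega j)))"
    by (intro sum_mono monoD[OF mono]) (use omega_prime_mult_le in auto)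
  also have "\<dots> \<le> (\<Sum>q | prime q \<and> q \<le> N. B * real N * (1 / real q))"
  proof (rule sum_mono)
    fix q assume "q \<in> {q. prime q \<and> q \<le> N}"
    have "(\<Sum>j=1..N div q. F (Suc (omega j))) \<le> B * real (N div q)"
      by (rule bd) (use Nn div_le_dividend le_trans in blast)
    also have "\<dots> \<le> B * (real N / real q)"
      using B by (intro mult_left_mono of_nat_div_le_of_nat) auto
    finally show "(\<Sum>j=1..N div q. F (Suc (omega j))) \<le> B * real N * (1 / real q)" by simp
  qed
  also have "\<dots> = B * real N * prime_reciprocals N"
    by (simp add: prime_reciprocals_def sum_distrib_left)
  also have "\<dots> \<le> B * real N * prime_reciprocals n"
    using B Nn by (intro mult_left_mono prime_reciprocals_mono) auto
  finally show ?thesis .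
qed

text \<open>
  Induction on \<open>r\<close>, splitting off one factor \<open>1 + \<omega>(k)\<close>. The bound is uniform in \<open>N \<le> n\<close> because the
  induction step replaces \<open>N\<close> by \<open>N div q\<close> while \<open>L\<^sub>n\<close> has to stay. Powers of \<open>1 + \<omega>\<close> rather than
  \<open>\<omega>\<close> are used since they grow by at most the factor \<open>2\<^sup>r\<close> when \<open>\<omega>\<close> increases by one.
\<close>
lemma omega_moments:
  "\<exists>C>0. \<forall>n. \<forall>N\<le>n. (\<Sum>k=1..N. (1 + real (omega k)) ^ r) \<le> C * real N * (1 + prime_reciprocals n) ^ r"
proof (induction r)
  case 0
  show ?case by (rule exI[of _ 1]) simp
next
  case (Suc r)
  then obtain C where C: "C > 0"
    and bd: "\<And>n N. N \<le> n \<Longrightarrow> (\<Sum>k=1..N. (1 + real (omega k)) ^ r) \<le> C * real N * (1 + prime_reciprocals n) ^ r"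
    by blast
  have "(\<Sum>k=1..N. (1 + real (omega k)) ^ Suc r) \<le> 2 ^ r * C * real N * (1 + prime_reciprocals n) ^ Suc r"
    if Nn: "N \<le> n" for n N
  proof -
    let ?L = "prime_reciprocals n"
    have L0: "?L \<ge> 0" by (rule prime_reciprocals_nonneg)
    define B where "B = 2 ^ r * C * (1 + ?L) ^ r"
    have B0: "B \<ge> 0" using C L0 by (simp add: B_def)
    have one: "(\<Sum>k=1..N. (1 + real (omega k)) ^ r) \<le> B * real N"
    proof -
      have "(\<Sum>k=1..N. (1 + real (omega k)) ^ r) \<le> 1 * (C * real N * (1 + ?L) ^ r)"
        using bd[OF Nn] by simp
      also have "\<dots> \<le> 2 ^ r * (C * real N * (1 + ?L) ^ r)"
        using C L0 by (intro mult_right_mono) auto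
      finally show ?thesis by (simp add: B_def mult_ac)
    qed
    have two: "(\<Sum>k=1..N. real (omega k) * (1 + real (omega k)) ^ r) \<le> B * real N * ?L"
    proof (rule sum_omega_mult_le[OF _ Nn _ B0])
      show "mono (\<lambda>m. (1 + real m) ^ r)" by (intro monoI power_mono) auto
      show "(\<Sum>j=1..M. (1 + real (Suc (omega j))) ^ r) \<le> B * real M" if "M \<le> n" for M
      proof -
        have "(\<Sum>j=1..M. (1 + real (Suc (omega j))) ^ r) \<le> (\<Sum>j=1..M. 2 ^ r * (1 + real (omega j)) ^ r)"
          by (intro sum_mono, subst power_mult_distrib[symmetric], intro power_mono) auto
        also have "\<dots> \<le> 2 ^ r * (C * real M * (1 + ?L) ^ r)"
          unfolding sum_distrib_left[symmetric] by (intro mult_left_mono bd that) auto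
        finally show ?thesis by (simp add: B_def mult_ac)
      qed
    qed
    have "(\<Sum>k=1..N. (1 + real (omega k)) ^ Suc r) =
        (\<Sum>k=1..N. (1 + real (omega k)) ^ r) + (\<Sum>k=1..N. real (omega k) * (1 + real (omega k)) ^ r)"
      by (simp add: sum.distrib[symmetric] algebra_simps)
    also have "\<dots> \<le> B * real N + B * real N * ?L" using one two by linarith
    finally show ?thesis by (simp add: B_def algebra_simps)
  qed
  then show ?case using C by (intro exI[of _ "2 ^ r * C"]) auto
qed

lemma sum_omega: "(\<Sum>k=1..N. real (omega k)) = (\<Sum>q | prime q \<and> q \<le> N. real (N div q))"
  using sum_omega_mult[of "\<lambda>_. 1" N] by simp

lemma sum_omega_le: "N \<le> n \<Longrightarrow> (\<Sum>k=1..N. real (omega k)) \<le> real N * prime_reciprocals n"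
  using sum_omega_mult_le[where F = "\<lambda>_. 1" and N = N and n = n and B = 1] by (simp add: mono_def)

text \<open>
  Replacing \<open>n div q\<close> by \<open>n / q\<close> costs at most \<open>1\<close> for each of the at most \<open>n\<close> primes.
\<close>
lemma sum_omega_ge: "(\<Sum>k=1..n. real (omega k)) \<ge> real n * prime_reciprocals n - real n"
proof -
  have "real n * prime_reciprocals n - real n \<le> (\<Sum>q | prime q \<and> q \<le> n. real n / real q) - real (card {q. prime q \<and> q \<le> n})"
  proof -
    have "card {q. prime q \<and> q \<le> n} \<le> card {1..n}"
      by (intro card_mono) (auto simp: prime_ge_Suc_0_nat)
    then show ?thesis by (simp add: prime_reciprocals_def sum_distrib_left)
  qed
  also have "\<dots> = (\<Sum>q | prime q \<and> q \<le> n. real n / real q - 1)"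
    by (simp add: sum_subtractf)
  also have "\<dots> \<le> (\<Sum>q | prime q \<and> q \<le> n. real (n div q))"
  proof (rule sum_mono)
    fix q assume "q \<in> {q. prime q \<and> q \<le> n}"
    then have "q > 0" by (auto simp: prime_gt_0_nat)
    then have "n < q * (n div q + 1)" using dividend_less_times_div[of q n] by (simp add: algebra_simps)
    then have "real n \<le> real (n div q) * real q + real q"
      by (metis add.commute distrib_left less_imp_le mult.commute mult.right_neutral of_nat_add of_nat_le_iff of_nat_mult)
    then show "real n / real q - 1 \<le> real (n div q)"
      using \<open>q > 0\<close> by (simp add: divide_le_eq add_divide_distrib[symmetric] algebra_simps)
  qed
  finally show ?thesis by (simp only: sum_omega)
qed

text \<open>
  Turan's estimate. After expanding the square, the terms of order \<open>n L\<^sub>n\<^sup>2\<close> cancel: the second moment of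
  \<open>\<omega>\<close> is at most \<open>n L\<^sub>n (1 + L\<^sub>n)\<close>, and the mixed term needs the lower bound for the first moment only.
\<close>
lemma turan_omega:
  "(\<Sum>k=1..n. (real (omega k) - prime_reciprocals n)\<^sup>2) \<le> 3 * real n * prime_reciprocals n"
proof -
  let ?L = "prime_reciprocals n"
  have L0: "?L \<ge> 0" by (rule prime_reciprocals_nonneg)
  have sq: "(\<Sum>k=1..n. real (omega k) * real (omega k)) \<le> (1 + ?L) * real n * ?L"
  proof (rule sum_omega_mult_le)
    show "(\<Sum>j=1..M. real (Suc (omega j))) \<le> (1 + ?L) * real M" if "M \<le> n" for M
      using sum_omega_le[OF that] by (simp add: sum.distrib algebra_simps)
  qed (use L0 in \<open>auto simp: mono_def\<close>)
  have "(\<Sum>k=1..n. (real (omega k) - ?L)\<^sup>2) =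
      (\<Sum>k=1..n. real (omega k) * real (omega k)) - 2 * ?L * (\<Sum>k=1..n. real (omega k)) + real n * ?L\<^sup>2"
    by (simp add: power2_eq_square algebra_simps sum.distrib sum_subtractf sum_distrib_left)
  also have "\<dots> \<le> (1 + ?L) * real n * ?L - 2 * ?L * (real n * ?L - real n) + real n * ?L\<^sup>2"
    using sq mult_left_mono[OF sum_omega_ge[of n], of "2 * ?L"] L0 by linarith
  also have "\<dots> = 3 * real n * ?L" by (simp add: power2_eq_square algebra_simps)
  finally show ?thesis .
qed

lemma sum_abs_omega_deviation:
  "(\<Sum>k=1..n. \<bar>real (omega k) - prime_reciprocals n\<bar>) \<le> 2 * real n * sqrt (prime_reciprocals n)"
proof -
  let ?L = "prime_reciprocals n"
  have L0: "?L \<ge> 0" by (rule prime_reciprocals_nonneg)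
  have "(\<Sum>k=1..n. \<bar>real (omega k) - ?L\<bar> * 1)\<^sup>2 \<le>
      (\<Sum>k=1..n. \<bar>real (omega k) - ?L\<bar>\<^sup>2) * (\<Sum>k=1..n. 1\<^sup>2)"
    by (rule Cauchy_Schwarz_ineq_sum)
  also have "\<dots> \<le> 3 * real n * ?L * real n"
    using turan_omega[of n] by (simp add: mult_right_mono)
  also have "\<dots> \<le> 4 * real n * ?L * real n"
    using L0 by (intro mult_right_mono) auto
  also have "\<dots> = (2 * real n * sqrt ?L)\<^sup>2"
    using L0 by (simp add: power2_eq_square algebra_simps)
  finally have "(\<Sum>k=1..n. \<bar>real (omega k) - ?L\<bar>)\<^sup>2 \<le> (2 * real n * sqrt ?L)\<^sup>2"
    by (simp only: mult_1_right)
  then show ?thesis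
    by (rule power2_le_imp_le) (simp add: L0)
qed

text \<open>
  One half of Euler's product formula, by induction on the set of primes: splitting off the power of the
  new prime \<open>q\<close> bounds the sum by a geometric series in \<open>1 / q\<close> times the sum for the smaller set.
\<close>
lemma smooth_reciprocals_le_prod:
  assumes "finite P" "\<And>q. q \<in> P \<Longrightarrow> prime q"
  shows "(\<Sum>k | k \<in> {1..N} \<and> prime_factors k \<subseteq> P. 1 / real k) \<le> (\<Prod>q\<in>P. 1 / (1 - 1 / real q))"
  using assms
proof (induction P)
  case empty
  have "{k. k \<in> {1..N} \<and> prime_factors k \<subseteq> {}} \<subseteq> {1}"
    by (auto simp: prime_factorization_empty_iff)
  then have "(\<Sum>k | k \<in> {1..N} \<and> prime_factors k \<subseteq> {}. 1 / real k) \<le> (\<Sum>k\<in>{1::nat}. 1 / real k)"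
    by (intro sum_mono2) auto
  then show ?case by simp
next
  case (insert q P)
  let ?S = "\<lambda>P. {k. k \<in> {1..N} \<and> prime_factors k \<subseteq> P}"
  have q: "prime q" "q \<ge> 2" using insert.prems by (auto simp: prime_ge_2_nat)
  have fin: "finite (?S P)" for P by (rule finite_subset[of _ "{1..N}"]) auto
  \<comment> \<open>The exponent of \<open>q\<close> in \<open>k\<close> is at most \<open>N\<close>, as \<open>m < q ^ m \<le> k \<le> N\<close>.\<close>
  have sub: "?S (insert q P) \<subseteq> (\<lambda>(m, k). q ^ m * k) ` ({..N} \<times> ?S P)"
  proof
    fix k assume k: "k \<in> ?S (insert q P)"
    define m where "m = multiplicity q k"
    obtain k' where k': "k = q ^ m * k'" "\<not> q dvd k'"
      using multiplicity_decompose'[of k q] k q unfolding m_def by (auto simp: prime_nat_iff)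
    have k0: "k' > 0" using k k' by (cases k') auto
    have "q ^ m \<le> k" "k' \<le> k" using k' k0 q by auto
    moreover have "m < q ^ m" using q by (intro less_exp[THEN less_le_trans] power_mono) auto
    moreover have "prime_factors k' \<subseteq> P"
    proof
      fix r assume r: "r \<in> prime_factors k'"
      then have "r \<in> prime_factors k" using k' k0 q by (auto simp: prime_factors_dvd)
      moreover have "r \<noteq> q" using r k' by auto
      ultimately show "r \<in> P" using k by auto
    qed
    ultimately have "(m, k') \<in> {..N} \<times> ?S P" using k k0 by auto
    then show "k \<in> (\<lambda>(m, k). q ^ m * k) ` ({..N} \<times> ?S P)" using k'(1) by force
  qed
  have "(\<Sum>k\<in>?S (insert q P). 1 / real k) \<le> (\<Sum>k\<in>(\<lambda>(m, k). q ^ m * k) ` ({..N} \<times> ?S P). 1 / real k)"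
    using fin by (intro sum_mono2 sub finite_imageI finite_cartesian_product) auto
  also have "\<dots> \<le> (\<Sum>mk\<in>{..N} \<times> ?S P. 1 / real ((\<lambda>(m, k). q ^ m * k) mk))"
    using fin by (intro sum_image_le[unfolded o_def]) auto
  also have "\<dots> = (\<Sum>m\<le>N. (1 / real q) ^ m) * (\<Sum>k\<in>?S P. 1 / real k)"
    by (simp add: sum_product sum.cartesian_product case_prod_unfold power_one_over)
  also have "\<dots> \<le> (1 / (1 - 1 / real q)) * (\<Prod>q\<in>P. 1 / (1 - 1 / real q))"
  proof (rule mult_mono)
    have "(\<Sum>m\<le>N. (1 / real q) ^ m) \<le> (\<Sum>m. (1 / real q) ^ m)"
      using q by (intro sum_le_suminf summable_geometric) auto
    also have "\<dots> = 1 / (1 - 1 / real q)" using q by (intro suminf_geometric) auto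
    finally show "(\<Sum>m\<le>N. (1 / real q) ^ m) \<le> 1 / (1 - 1 / real q)" .
    show "(\<Sum>k\<in>?S P. 1 / real k) \<le> (\<Prod>q\<in>P. 1 / (1 - 1 / real q))"
      using insert.IH insert.prems by auto
    show "0 \<le> 1 / (1 - 1 / real q)" using q by auto
  qed (auto intro: sum_nonneg)
  also have "\<dots> = (\<Prod>q\<in>insert q P. 1 / (1 - 1 / real q))"
    using insert.hyps by simp
  finally show ?case .
qed

text \<open>
  All integers up to \<open>n\<close> are composed of primes up to \<open>n\<close>, and \<open>1 / (1 - x) \<le> exp (2 x)\<close> for
  \<open>0 \<le> x \<le> 1 / 2\<close> turns the Euler product into an exponential. Thus the divergence of the harmonic
  series forces that of the reciprocals of the primes.
\<close>
lemma harm_le_exp_prime_reciprocals: "harm n \<le> exp (2 * prime_reciprocals n)"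
proof -
  let ?P = "{q. prime q \<and> q \<le> n}"
  have "{k. k \<in> {1..n} \<and> prime_factors k \<subseteq> ?P} = {1..n}"
    by (auto simp: prime_factors_dvd intro: order_trans[OF dvd_imp_le])
  then have "harm n = (\<Sum>k | k \<in> {1..n} \<and> prime_factors k \<subseteq> ?P. 1 / real k)"
    by (simp add: harm_def inverse_eq_divide)
  also have "\<dots> \<le> (\<Prod>q\<in>?P. 1 / (1 - 1 / real q))"
    by (rule smooth_reciprocals_le_prod) auto
  also have "\<dots> \<le> (\<Prod>q\<in>?P. exp (2 * (1 / real q)))"
  proof (rule prod_mono)
    fix q assume "q \<in> ?P"
    then have q: "q \<ge> 2" by (auto simp: prime_ge_2_nat)
    define x where "x = 1 / real q"
    have x: "0 \<le> x" "x \<le> 1 / 2" using q by (auto simp: x_def field_simps)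
    have "1 \<le> (1 + 2 * x) * (1 - x)" using x mult_nonneg_nonneg[of x "1 - 2 * x"] by (simp add: algebra_simps)
    then have "1 / (1 - x) \<le> 1 + 2 * x" using x by (simp add: field_simps)
    also have "\<dots> \<le> exp (2 * x)" by (rule exp_ge_add_one_self)
    finally show "0 \<le> 1 / (1 - 1 / real q) \<and> 1 / (1 - 1 / real q) \<le> exp (2 * (1 / real q))"
      using x by (simp add: x_def)
  qed
  also have "\<dots> = exp (2 * prime_reciprocals n)"
    by (simp add: prime_reciprocals_def exp_sum sum_distrib_left)
  finally show ?thesis .
qed

lemma prime_reciprocals_at_top: "filterlim prime_reciprocals at_top sequentially"
proof (rule filterlim_at_top_mono)
  show "filterlim (\<lambda>n. 1 / 2 * ln (harm n) :: real) at_top sequentially"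
    by (rule filterlim_tendsto_pos_mult_at_top[OF tendsto_const _
        filterlim_compose[OF ln_at_top harm_at_top]]) simp
  show "\<forall>\<^sub>F n in sequentially. 1 / 2 * ln (harm n) \<le> prime_reciprocals n"
    using eventually_gt_at_top[of 0]
  proof eventually_elim
    case (elim n)
    then have "harm n > (0::real)" by (intro harm_pos) auto
    then have "ln (harm n) \<le> 2 * prime_reciprocals n"
      using harm_le_exp_prime_reciprocals[of n] by (metis ln_exp ln_le_cancel_iff exp_gt_zero)
    then show ?case by simp
  qed
qed

section \<open>Comparison of an additive function with the number of prime divisors\<close>

text \<open>
  The witness \<open>a\<close> is the product of the prime powers \<open>q ^ (m div 2)\<close>, where \<open>q ^ m\<close> is the exact power
  of \<open>q\<close> in \<open>k\<close>. Primes with \<open>m = 1\<close> do not contribute to the difference because \<open>g q = 1\<close>; for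
  \<open>m \<ge> 2\<close> the factor \<open>3\<close> comes from \<open>m \<le> 3 (m div 2)\<close>, and \<open>1 / ln 2\<close> absorbs the value \<open>1\<close> that
  \<open>\<omega>\<close> assigns to \<open>q ^ m\<close>.
\<close>
lemma additive_minus_omega_le_ln_square_divisor:
  fixes g :: "nat \<Rightarrow> nat"
  assumes add: "additive_function g" and prime1: "\<And>q. prime q \<Longrightarrow> g q = 1" and \<beta>: "\<beta> > 0"
    and bd: "\<And>m q. m \<ge> 1 \<Longrightarrow> prime q \<Longrightarrow> real (g (q ^ m)) \<le> \<beta> * real m * ln (real q)"
    and k: "k \<ge> 1"
  shows "\<exists>a\<ge>1. a\<^sup>2 dvd k \<and> \<bar>real (g k) - real (omega k)\<bar> \<le> 3 * (\<beta> + 1 / ln 2) * ln (real a)"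
  using k
proof (induction k rule: less_induct)
  case (less k)
  let ?C = "\<beta> + 1 / ln 2"
  have C0: "?C > 0" using \<beta> by (simp add: add_pos_pos)
  show ?case
  proof (cases "k = 1")
    case True
    have "g (1 * 1) = g 1 + g 1"
      using add unfolding additive_function_def by (metis coprime_1_left le_refl)
    then show ?thesis using True by (intro exI[of _ 1]) (simp add: omega_def)
  next
    case False
    then obtain q where q: "prime q" "q dvd k" using prime_factor_nat by blast
    define m where "m = multiplicity q k"
    obtain k' where k': "k = q ^ m * k'" "\<not> q dvd k'"
      using multiplicity_decompose'[of k q] less.prems q unfolding m_def by (auto simp: prime_nat_iff)
    have m: "m \<ge> 1" using k' q by (cases m) auto
    have k0: "k' \<ge> 1" using k' less.prems by (cases k') auto
    have q2: "q \<ge> 2" using q by (simp add: prime_ge_2_nat)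
    have "1 < q ^ m" using m q2 by (intro one_less_power) auto
    then have "k' < k" using k' k0 by auto
    then obtain a where a: "a \<ge> 1" "a\<^sup>2 dvd k'"
      "\<bar>real (g k') - real (omega k')\<bar> \<le> 3 * ?C * ln (real a)"
      using less.IH k0 by blast
    have cop: "coprime (q ^ m) k'"
      using prime_imp_coprime[OF q(1) k'(2)] by simp
    have gk: "g k = g (q ^ m) + g k'"
      using add k' k0 cop q2 unfolding additive_function_def by simp
    have "prime_factors k = insert q (prime_factors k')"
      using q k' k0 m q2
      by (auto simp: prime_factors_dvd prime_dvd_mult_iff prime_dvd_power_iff primes_dvd_imp_eq)
    moreover have "q \<notin> prime_factors k'" using k' by auto
    ultimately have omk: "omega k = 1 + omega k'" by (simp add: omega_def)
    have dev: "\<bar>real (g (q ^ m)) - 1\<bar> \<le> 3 * ?C * (real (m div 2) * ln (real q))"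
    proof (cases "m = 1")
      case True
      then show ?thesis using prime1[OF q(1)] by simp
    next
      case False
      then have m3: "m \<le> 3 * (m div 2)" using m by presburger
      have "ln 2 \<le> ln (real q)" using q2 by simp
      also have "\<dots> \<le> real m * ln (real q)" using m q2 by (simp add: mult_le_cancel_right1)
      finally have "1 \<le> 1 / ln 2 * (real m * ln (real q))" by (simp add: field_simps)
      moreover have "\<bar>real (g (q ^ m)) - 1\<bar> \<le> \<beta> * real m * ln (real q) + 1"
        using bd[OF m q(1)] by linarith
      ultimately have "\<bar>real (g (q ^ m)) - 1\<bar> \<le> ?C * (real m * ln (real q))"
        unfolding distrib_right mult.assoc by linarith
      also have "\<dots> \<le> ?C * (real (3 * (m div 2)) * ln (real q))"
        using C0 m3 q2 by (intro mult_left_mono mult_right_mono of_nat_mono) auto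
      also have "\<dots> = 3 * ?C * (real (m div 2) * ln (real q))"
        by (simp only: of_nat_mult of_nat_numeral mult_ac)
      finally show ?thesis .
    qed
    show ?thesis
    proof (intro exI[of _ "q ^ (m div 2) * a"] conjI)
      show "1 \<le> q ^ (m div 2) * a" using a q2 by simp
      have "(q ^ (m div 2))\<^sup>2 dvd q ^ m"
        unfolding power_mult[symmetric] by (rule le_imp_power_dvd) simp
      then show "(q ^ (m div 2) * a)\<^sup>2 dvd k"
        unfolding power_mult_distrib k'(1) using a(2) by (rule mult_dvd_mono)
      have "ln (real (q ^ (m div 2) * a)) = real (m div 2) * ln (real q) + ln (real a)"
        using a q2 by (simp add: ln_mult ln_realpow)
      then have "3 * ?C * ln (real (q ^ (m div 2) * a)) =
          3 * ?C * (real (m div 2) * ln (real q)) + 3 * ?C * ln (real a)"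
        by (simp only: distrib_left)
      moreover have "\<bar>real (g k) - real (omega k)\<bar> \<le>
          \<bar>real (g (q ^ m)) - 1\<bar> + \<bar>real (g k') - real (omega k')\<bar>"
        by (simp add: gk omk)
      ultimately show "\<bar>real (g k) - real (omega k)\<bar> \<le> 3 * ?C * ln (real (q ^ (m div 2) * a))"
        using dev a(3) by linarith
    qed
  qed
qed

lemma ln_power_le_sqrt:
  assumes "r \<ge> 1" "x \<ge> 1"
  shows "ln x ^ r \<le> (2 * real r) ^ r * sqrt x"
proof -
  have "ln x \<le> x powr (1 / (2 * real r)) / (1 / (2 * real r))"
    using assms by (intro ln_powr_bound) auto
  then have "ln x ^ r \<le> (2 * real r * x powr (1 / (2 * real r))) ^ r"
    using assms by (intro power_mono) (auto simp: mult.commute)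
  also have "\<dots> = (2 * real r) ^ r * (x powr (1 / (2 * real r))) powr real r"
    using assms by (simp add: power_mult_distrib powr_realpow)
  also have "\<dots> = (2 * real r) ^ r * sqrt x"
    using assms by (simp add: powr_powr powr_half_sqrt)
  finally show ?thesis .
qed

text \<open>
  At most \<open>n / a\<^sup>2\<close> integers up to \<open>n\<close> are divisible by \<open>a\<^sup>2\<close>, so the sum is at most \<open>n\<close> times the
  convergent series of \<open>(C ln a)\<^sup>r / a\<^sup>2\<close>, whose terms are \<open>O(a\<^sup>-\<^sup>3\<^sup>/\<^sup>2)\<close>.
\<close>
lemma moments_of_ln_square_divisor:
  fixes h :: "nat \<Rightarrow> real"
  assumes r: "r \<ge> 1" and C: "C \<ge> 0"
    and h: "\<And>k. k \<ge> 1 \<Longrightarrow> \<exists>a\<ge>1. a\<^sup>2 dvd k \<and> \<bar>h k\<bar> \<le> C * ln (real a)"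
  shows "\<exists>K\<ge>0. \<forall>n. (\<Sum>k=1..n. \<bar>h k\<bar> ^ r) \<le> K * real n"
proof -
  define D where "D = (C * (2 * real r)) ^ r"
  have D0: "D \<ge> 0" using C by (simp add: D_def)
  have summ: "summable (\<lambda>a. real a powr (- 3 / 2))"
    by (simp add: summable_real_powr_iff)
  define S where "S = (\<Sum>a. real a powr (- 3 / 2))"
  have S0: "S \<ge> 0" unfolding S_def by (intro suminf_nonneg summ) simp
  have "(\<Sum>k=1..n. \<bar>h k\<bar> ^ r) \<le> D * S * real n" for n
  proof -
    have "(\<Sum>k=1..n. \<bar>h k\<bar> ^ r) \<le> (\<Sum>k=1..n. \<Sum>a | a \<in> {1..n} \<and> a\<^sup>2 dvd k. (C * ln (real a)) ^ r)"
    proof (rule sum_mono)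
      fix k assume k: "k \<in> {1..n}"
      then obtain a where a: "a \<ge> 1" "a\<^sup>2 dvd k" "\<bar>h k\<bar> \<le> C * ln (real a)"
        using h[of k] by auto
      have "a \<le> a\<^sup>2" using a(1) by (simp add: power2_eq_square)
      also have "\<dots> \<le> n" using a(2) k by (auto dest!: dvd_imp_le)
      finally have an: "a \<in> {a. a \<in> {1..n} \<and> a\<^sup>2 dvd k}" using a by auto
      have "\<bar>h k\<bar> ^ r \<le> (C * ln (real a)) ^ r" using a(3) by (intro power_mono) auto
      also have "\<dots> \<le> (\<Sum>a | a \<in> {1..n} \<and> a\<^sup>2 dvd k. (C * ln (real a)) ^ r)"
        using C by (intro member_le_sum[OF an]) auto
      finally show "\<bar>h k\<bar> ^ r \<le> \<dots>" .
    qed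
    also have "\<dots> = (\<Sum>a=1..n. \<Sum>k | k \<in> {1..n} \<and> a\<^sup>2 dvd k. (C * ln (real a)) ^ r)"
      by (rule sum.swap_restrict) auto
    also have "\<dots> \<le> (\<Sum>a=1..n. D * real n * real a powr (- 3 / 2))"
    proof (rule sum_mono)
      fix a assume a: "a \<in> {1..n}"
      then have "a\<^sup>2 > 0" by simp
      have "(\<Sum>k | k \<in> {1..n} \<and> a\<^sup>2 dvd k. (C * ln (real a)) ^ r) = real (n div a\<^sup>2) * (C * ln (real a)) ^ r"
        using sum_multiples[OF \<open>a\<^sup>2 > 0\<close>, of "\<lambda>_. (C * ln (real a)) ^ r" n] by simp
      also have "\<dots> \<le> (real n / real (a\<^sup>2)) * (D * sqrt (real a))"
      proof (rule mult_mono)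
        show "(C * ln (real a)) ^ r \<le> D * sqrt (real a)"
          using ln_power_le_sqrt[OF r, of "real a"] a C
          by (auto simp: D_def power_mult_distrib mult.assoc intro!: mult_left_mono)
      qed (use a C of_nat_div_le_of_nat[of n "a\<^sup>2", where ?'a = real] in auto)
      also have "real n / real (a\<^sup>2) * (D * sqrt (real a)) = D * real n * (real a powr (1/2) * real a powr (- 2))"
        using a by (simp add: powr_half_sqrt powr_minus powr_numeral field_simps)
      also have "real a powr (1/2) * real a powr (- 2) = real a powr (- 3 / 2)"
        using a by (simp add: powr_add[symmetric])
      finally show "(\<Sum>k | k \<in> {1..n} \<and> a\<^sup>2 dvd k. (C * ln (real a)) ^ r) \<le> D * real n * real a powr (- 3 / 2)" .
    qed
    also have "\<dots> = D * real n * (\<Sum>a=1..n. real a powr (- 3 / 2))"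
      by (simp add: sum_distrib_left)
    also have "\<dots> \<le> D * real n * S"
      unfolding S_def using D0 by (intro mult_left_mono sum_le_suminf summ) auto
    finally show ?thesis by (simp add: mult_ac)
  qed
  then show ?thesis using D0 S0 by (intro exI[of _ "D * S"]) auto
qed

lemma power_add_le: 
  fixes a b :: real
  assumes "a \<ge> 0" "b \<ge> 0"
  shows "(a + b) ^ r \<le> 2 ^ r * (a ^ r + b ^ r)"
proof -
  have "(a + b) ^ r \<le> (2 * max a b) ^ r" using assms by (intro power_mono) auto
  also have "\<dots> \<le> 2 ^ r * (a ^ r + b ^ r)"
    using assms by (auto simp: power_mult_distrib max_def)
  finally show ?thesis .
qed

text \<open>
  All three estimates come from \<open>W\<^sub>n \<ge> n L\<^sub>n - O(n)\<close>, which makes \<open>W\<^sub>n / n\<close> at least comparable with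
  \<open>1 + L\<^sub>n\<close> for large \<open>n\<close>. For the moment bound this must hold for all \<open>n \<ge> 2\<close>, not only eventually; for \<open>n = 1\<close>
  both sides of that bound vanish, since \<open>g 1 = 0\<close>.
\<close>
lemma additive_weight_estimates:
  fixes g :: "nat \<Rightarrow> nat"
  assumes add: "additive_function g" and prime1: "\<And>q. prime q \<Longrightarrow> g q = 1"
    and "\<exists>\<beta>>0. \<forall>m\<ge>1. \<forall>q::nat. prime q \<longrightarrow> real (g (q ^ m)) \<le> \<beta> * real m * ln (real q)"
  defines "W \<equiv> total_weight (\<lambda>n. real (g n))"
  shows "filterlim W at_top sequentially"
    and "r \<ge> 1 \<Longrightarrow> \<exists>K\<ge>0. \<forall>n. (\<Sum>k=1..n. real (g k) ^ r) \<le> K * real n * (W n / real n) ^ r"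
    and "(\<lambda>n. (\<Sum>k=1..n. \<bar>real (g k) - prime_reciprocals n\<bar>) / W n) \<longlonglongrightarrow> 0"
proof -
  let ?L = prime_reciprocals
  define h where "h k = real (g k) - real (omega k)" for k
  obtain \<beta> where \<beta>: "\<beta> > 0"
    and bd: "\<And>m q. m \<ge> 1 \<Longrightarrow> prime q \<Longrightarrow> real (g (q ^ m)) \<le> \<beta> * real m * ln (real q)"
    using assms(3) by blast
  have h_moment: "\<exists>K\<ge>0. \<forall>n. (\<Sum>k=1..n. \<bar>h k\<bar> ^ r) \<le> K * real n" if "r \<ge> 1" for r
    by (rule moments_of_ln_square_divisor[OF that, of "3 * (\<beta> + 1 / ln 2)"])
      (use \<beta> additive_minus_omega_le_ln_square_divisor[OF add prime1 \<beta> bd] in \<open>auto simp: h_def\<close>)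
  obtain K1 where K1: "K1 \<ge> 0" "\<And>n. (\<Sum>k=1..n. \<bar>h k\<bar>) \<le> K1 * real n"
    using h_moment[of 1] by auto
  have L0: "?L n \<ge> 0" for n by (rule prime_reciprocals_nonneg)
  have W_def': "W n = (\<Sum>k=1..n. real (g k))" for n by (simp add: W_def total_weight_def)
  have W_ge: "W n \<ge> real n * ?L n - (1 + K1) * real n" for n
  proof -
    have "W n = (\<Sum>k=1..n. real (omega k)) + (\<Sum>k=1..n. h k)"
      by (simp add: W_def' h_def sum.distrib[symmetric])
    moreover have "\<bar>\<Sum>k=1..n. h k\<bar> \<le> K1 * real n"
      using K1(2)[of n] sum_abs[of h "{1..n}"] by linarith
    ultimately show ?thesis using sum_omega_ge[of n] by (simp add: algebra_simps abs_le_iff)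
  qed
  have evL: "eventually (\<lambda>n. ?L n \<ge> 2 * (1 + K1)) sequentially"
    using prime_reciprocals_at_top by (simp add: filterlim_at_top)
  have half: "W n \<ge> real n * ?L n / 2" if "?L n \<ge> 2 * (1 + K1)" for n
  proof -
    have "real n * (?L n / 2) \<ge> real n * (1 + K1)" using that by (intro mult_left_mono) auto
    then show ?thesis using W_ge[of n] by (simp add: algebra_simps)
  qed
  have half': "W n \<ge> real n" if "?L n \<ge> 2 * (1 + K1)" for n
  proof -
    have "real n * (?L n / 2) \<ge> real n * 1" using that K1 by (intro mult_left_mono) auto
    then show ?thesis using half[OF that] by simp
  qed
  show "filterlim W at_top sequentially"
    by (rule filterlim_at_top_mono[OF filterlim_real_sequentially])
      (use evL half' in \<open>auto elim: eventually_mono\<close>)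

  show "(\<lambda>n. (\<Sum>k=1..n. \<bar>real (g k) - ?L n\<bar>) / W n) \<longlonglongrightarrow> 0"
  proof (rule tendsto_sandwich[OF _ _ tendsto_const])
    have "((\<lambda>x::real. 4 / sqrt x + 2 * K1 / x) \<longlongrightarrow> 0) at_top" by real_asymp
    then show "(\<lambda>n. 4 / sqrt (?L n) + 2 * K1 / ?L n) \<longlonglongrightarrow> 0"
      by (rule filterlim_compose[OF _ prime_reciprocals_at_top])
    show "\<forall>\<^sub>F n in sequentially. 0 \<le> (\<Sum>k=1..n. \<bar>real (g k) - ?L n\<bar>) / W n"
      by (auto intro!: always_eventually divide_nonneg_nonneg sum_nonneg simp: W_def')
    show "\<forall>\<^sub>F n in sequentially. (\<Sum>k=1..n. \<bar>real (g k) - ?L n\<bar>) / W n \<le> 4 / sqrt (?L n) + 2 * K1 / ?L n"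
      using evL eventually_gt_at_top[of 0]
    proof eventually_elim
      case (elim n)
      have L: "?L n > 0" by (rule less_le_trans[OF _ elim(1)]) (use K1(1) in simp)
      have "(\<Sum>k=1..n. \<bar>real (g k) - ?L n\<bar>) \<le>
          (\<Sum>k=1..n. \<bar>h k\<bar> + \<bar>real (omega k) - ?L n\<bar>)"
        by (intro sum_mono) (auto simp: h_def)
      also have "\<dots> \<le> K1 * real n + 2 * real n * sqrt (?L n)"
        unfolding sum.distrib using K1(2)[of n] sum_abs_omega_deviation[of n] by linarith
      finally have "(\<Sum>k=1..n. \<bar>real (g k) - ?L n\<bar>) / W n \<le>
          (K1 * real n + 2 * real n * sqrt (?L n)) / (real n * ?L n / 2)"
        using half elim L K1 by (intro frac_le) auto
      also have "\<dots> = 2 * K1 / ?L n + 4 * (sqrt (?L n) / ?L n)"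
        using elim L by (simp add: field_simps)
      also have "sqrt (?L n) / ?L n = 1 / sqrt (?L n)"
        using L by (simp add: sqrt_divide_self_eq inverse_eq_divide)
      finally show ?case by simp
    qed
  qed

  assume r: "r \<ge> 1"
  obtain n0 where n0: "\<And>n. n \<ge> n0 \<Longrightarrow> ?L n \<ge> 2 * (1 + K1)"
    using evL unfolding eventually_sequentially by blast
  define c where "c = max 3 (real n0 * (1 + ?L n0))"
  have c: "real n * (1 + ?L n) \<le> c * W n" if n: "n \<ge> 2" for n
  proof (cases "n \<ge> n0")
    case True
    have "real n * (1 + ?L n) \<le> W n + 2 * W n"
      using half[OF n0[OF True]] half'[OF n0[OF True]] by (simp add: algebra_simps)
    also have "\<dots> = 3 * W n" by simp
    also have "\<dots> \<le> c * W n"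
      unfolding c_def by (intro mult_right_mono) (auto simp: W_def' sum_nonneg)
    finally show ?thesis .
  next
    case False
    \<comment> \<open>The finitely many remaining \<open>n\<close> are covered by \<open>W n \<ge> g 2 = 1\<close>.\<close>
    have "real (g 2) \<le> W n" unfolding W_def' using n by (intro member_le_sum) auto
    then have W1: "1 \<le> W n" using prime1[of 2] by simp
    have "real n * (1 + ?L n) \<le> real n0 * (1 + ?L n0)"
      using False L0[of n] by (intro mult_mono add_mono prime_reciprocals_mono) auto
    also have "\<dots> \<le> c" by (simp add: c_def)
    also have "\<dots> \<le> c * W n" using W1 by (simp add: c_def mult_le_cancel_left1)
    finally show ?thesis .
  qed
  obtain C where C: "C > 0" "\<And>n. (\<Sum>k=1..n. (1 + real (omega k)) ^ r) \<le> C * real n * (1 + ?L n) ^ r"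
    using omega_moments[of r] by blast
  obtain K where K: "K \<ge> 0" "\<And>n. (\<Sum>k=1..n. \<bar>h k\<bar> ^ r) \<le> K * real n"
    using h_moment[OF r] by blast
  have c0: "c \<ge> 0" by (simp add: c_def)
  have "(\<Sum>k=1..n. real (g k) ^ r) \<le> (2 ^ r * (C + K) * c ^ r) * real n * (W n / real n) ^ r" for n
  proof -
    consider "n = 0" | "n = 1" | "n \<ge> 2" by linarith
    then show ?thesis
    proof cases
      case 2
      have "g (1 * 1) = g 1 + g 1"
        using add unfolding additive_function_def by (metis coprime_1_left le_refl)
      then show ?thesis using 2 r by (simp add: W_def' power_0_left)
    next
      case 3
      have "(\<Sum>k=1..n. real (g k) ^ r) \<le> (\<Sum>k=1..n. 2 ^ r * ((1 + real (omega k)) ^ r + \<bar>h k\<bar> ^ r))"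
      proof (rule sum_mono)
        fix k
        have "real (g k) ^ r \<le> (1 + real (omega k) + \<bar>h k\<bar>) ^ r"
          by (intro power_mono) (auto simp: h_def)
        also have "\<dots> \<le> 2 ^ r * ((1 + real (omega k)) ^ r + \<bar>h k\<bar> ^ r)"
          by (rule power_add_le) auto
        finally show "real (g k) ^ r \<le> \<dots>" .
      qed
      also have "\<dots> \<le> 2 ^ r * (C * real n * (1 + ?L n) ^ r + K * real n * (1 + ?L n) ^ r)"
      proof -
        have "K * real n * 1 \<le> K * real n * (1 + ?L n) ^ r"
          using K L0[of n] by (intro mult_left_mono one_le_power) auto
        then show ?thesis
          unfolding sum_distrib_left[symmetric] sum.distrib using C(2)[of n] K(2)[of n]
          by (intro mult_left_mono) auto
      qed
      also have "\<dots> = 2 ^ r * (C + K) * real n * (1 + ?L n) ^ r"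
        by (simp add: algebra_simps)
      also have "\<dots> \<le> 2 ^ r * (C + K) * real n * (c * (W n / real n)) ^ r"
        using C(1) K(1) L0[of n] c[OF 3] 3
        by (intro mult_left_mono power_mono) (auto simp: field_simps)
      also have "(c * (W n / real n)) ^ r = c ^ r * (W n / real n) ^ r"
        by (rule power_mult_distrib)
      finally show ?thesis by (simp only: mult_ac)
    qed simp
  qed
  then show "\<exists>K\<ge>0. \<forall>n. (\<Sum>k=1..n. real (g k) ^ r) \<le> K * real n * (W n / real n) ^ r"
    using C(1) K(1) c0 by (intro exI[of _ "2 ^ r * (C + K) * c ^ r"]) auto
qed

section \<open>Maximal inequality and pointwise convergence for bounded functions\<close>

context dynamical_system
begin

lemma funpow_measurable: "\<tau> ^^ k \<in> measurable M M"
  by (rule measurable_compose_n[OF measurable_map])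

lemma funpow_in_space: "x \<in> space M \<Longrightarrow> (\<tau> ^^ k) x \<in> space M"
  using measurable_space[OF funpow_measurable] .

lemma measurable_iterate:
  "f \<in> measurable M N \<Longrightarrow> (\<lambda>x. f ((\<tau> ^^ k) x)) \<in> measurable M N"
  by (rule measurable_compose[OF funpow_measurable])

lemma
  fixes f :: "'a \<Rightarrow> real"
  assumes "integrable M f"
  shows integrable_map: "integrable M (\<lambda>x. f (\<tau> x))"
    and integral_map: "(\<integral>x. f (\<tau> x) \<partial>M) = (\<integral>x. f x \<partial>M)"
  using integrable_distr_eq[OF measurable_map, of f] integral_distr[OF measurable_map, of f] assms
  by (auto simp: preserves_measure)

lemma emeasure_map:
  assumes "A \<in> sets M"
  shows "emeasure M {x \<in> space M. \<tau> x \<in> A} = emeasure M A"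
proof -
  have "emeasure M A = emeasure (distr M M \<tau>) A" by (simp add: preserves_measure)
  also have "\<dots> = emeasure M (\<tau> -` A \<inter> space M)" by (rule emeasure_distr[OF measurable_map assms])
  also have "\<tau> -` A \<inter> space M = {x \<in> space M. \<tau> x \<in> A}" by auto
  finally show ?thesis by simp
qed

lemma AE_map:
  assumes "AE x in M. P x"
  shows "AE x in M. P (\<tau> x)"
  by (rule AE_distrD[OF measurable_map]) (use assms in \<open>simp only: preserves_measure\<close>)

definition birkhoff_sum :: "('a \<Rightarrow> 'b::comm_monoid_add) \<Rightarrow> nat \<Rightarrow> 'a \<Rightarrow> 'b" where
  "birkhoff_sum f n x = (\<Sum>k<n. f ((\<tau> ^^ k) x))"

lemma birkhoff_sum_0 [simp]: "birkhoff_sum f 0 x = 0"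
  by (simp add: birkhoff_sum_def)

lemma birkhoff_sum_Suc: "birkhoff_sum f (Suc n) x = f x + birkhoff_sum f n (\<tau> x)"
  unfolding birkhoff_sum_def by (subst sum.lessThan_Suc_shift) (simp add: funpow_swap1)

lemma birkhoff_sum_map:
  "birkhoff_sum f n (\<tau> x) = (\<Sum>k=1..n. f ((\<tau> ^^ k) x))"
  unfolding birkhoff_sum_def
  by (rule sum.reindex_bij_witness[of _ "\<lambda>k. k - 1" Suc]) (auto simp: funpow_swap1 gr0_conv_Suc Suc_le_eq)

lemma birkhoff_sum_measurable [measurable]:
  fixes f :: "'a \<Rightarrow> real"
  assumes "f \<in> borel_measurable M"
  shows "birkhoff_sum f n \<in> borel_measurable M"
  unfolding birkhoff_sum_def using measurable_iterate[OF assms] by (intro borel_measurable_sum)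

text \<open>
  The maximum of the Birkhoff sums of lengths \<open>0, \<dots>, N\<close>, in the recursive form that relates its value
  at \<open>x\<close> to its value at \<open>\<tau> x\<close>.
\<close>
primrec max_birkhoff_sum :: "('a \<Rightarrow> real) \<Rightarrow> nat \<Rightarrow> 'a \<Rightarrow> real" where
  "max_birkhoff_sum f 0 x = 0"
| "max_birkhoff_sum f (Suc N) x = max 0 (f x + max_birkhoff_sum f N (\<tau> x))"

lemma max_birkhoff_sum_nonneg: "0 \<le> max_birkhoff_sum f N x"
  by (cases N) auto

lemma max_birkhoff_sum_mono: "max_birkhoff_sum f N x \<le> max_birkhoff_sum f (Suc N) x"
proof (induction N arbitrary: x)
  case (Suc N)
  then show ?case
    unfolding max_birkhoff_sum.simps(2)[of f "Suc N"] max_birkhoff_sum.simps(2)[of f N x]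
    by (intro max.mono add_left_mono) auto
qed simp

lemma max_birkhoff_sum_pos_iff:
  "max_birkhoff_sum f N x > 0 \<longleftrightarrow> (\<exists>n\<le>N. birkhoff_sum f n x > 0)"
proof -
  have upper: "n \<le> N \<Longrightarrow> birkhoff_sum f n x \<le> max_birkhoff_sum f N x" for n x
  proof (induction N arbitrary: n x)
    case (Suc N)
    then show ?case
      by (cases n) (auto simp: birkhoff_sum_Suc intro: max.coboundedI2)
  qed simp
  have attained: "\<exists>n\<le>N. birkhoff_sum f n x = max_birkhoff_sum f N x" for x
  proof (induction N arbitrary: x)
    case (Suc N)
    obtain n where n: "n \<le> N" "birkhoff_sum f n (\<tau> x) = max_birkhoff_sum f N (\<tau> x)"
      using Suc.IH by blast
    show ?case
    proof (cases "f x + max_birkhoff_sum f N (\<tau> x) \<le> 0")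
      case True
      then show ?thesis by (intro exI[of _ 0]) auto
    next
      case False
      then show ?thesis using n by (intro exI[of _ "Suc n"]) (auto simp: birkhoff_sum_Suc)
    qed
  qed simp
  show ?thesis using upper attained by (metis less_le_trans)
qed

lemma max_birkhoff_sum_integrable: "integrable M f \<Longrightarrow> integrable M (max_birkhoff_sum f N)"
proof (induction N)
  case 0
  have "max_birkhoff_sum f 0 = (\<lambda>x. 0)" by auto
  then show ?case by simp
next
  case (Suc N)
  have "max_birkhoff_sum f (Suc N) = (\<lambda>x. max 0 (f x + max_birkhoff_sum f N (\<tau> x)))" by auto
  then show ?case using Suc integrable_map by simp
qed

text \<open>
  Let \<open>m\<close> be the maximum of the Birkhoff sums of lengths up to \<open>N\<close>. The recursion and monotonicity in
  \<open>N\<close> give \<open>m - m \<circ> \<tau> \<le> f\<close> where \<open>m > 0\<close>, and \<open>m - m \<circ> \<tau> \<le> 0\<close> where \<open>m = 0\<close>. The integral of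
  \<open>m - m \<circ> \<tau>\<close> is \<open>0\<close> because \<open>\<tau>\<close> preserves the measure.
\<close>
lemma hopf_maximal_finite:
  fixes f :: "'a \<Rightarrow> real"
  assumes f: "integrable M f"
  shows "0 \<le> (\<integral>x. indicator {x \<in> space M. \<exists>n\<le>N. birkhoff_sum f n x > 0} x * f x \<partial>M)"
proof -
  let ?m = "max_birkhoff_sum f N"
  let ?H = "{x \<in> space M. ?m x > 0}"
  note int = max_birkhoff_sum_integrable[OF f, of N]
  have "0 = (\<integral>x. ?m x - ?m (\<tau> x) \<partial>M)"
    using int by (simp add: integral_map integrable_map)
  also have "\<dots> \<le> (\<integral>x. indicator ?H x * f x \<partial>M)"
  proof (rule integral_mono)
    show "integrable M (\<lambda>x. ?m x - ?m (\<tau> x))" using int integrable_map by auto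
    have "?H \<in> sets M" using borel_measurable_integrable[OF int] by measurable
    then show "integrable M (\<lambda>x. indicator ?H x * f x)"
      using integrable_mult_indicator[OF _ f, of ?H] by simp
    fix x assume x: "x \<in> space M"
    show "?m x - ?m (\<tau> x) \<le> indicator ?H x * f x"
    proof (cases "?m x > 0")
      case True
      then obtain N' where N': "N = Suc N'" by (cases N) auto
      have "?m x \<le> f x + max_birkhoff_sum f N' (\<tau> x)" using True by (auto simp: N' max_def split: if_splits)
      also have "\<dots> \<le> f x + ?m (\<tau> x)" unfolding N' by (intro add_left_mono max_birkhoff_sum_mono)
      finally show ?thesis using True x by simp
    next
      case False
      then show ?thesis using max_birkhoff_sum_nonneg[of f N "\<tau> x"] by simp
    qed
  qed
  finally show ?thesis unfolding max_birkhoff_sum_pos_iff .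
qed

theorem hopf_maximal:
  fixes f :: "'a \<Rightarrow> real"
  assumes f: "integrable M f"
  shows "0 \<le> (\<integral>x. indicator {x \<in> space M. \<exists>n. birkhoff_sum f n x > 0} x * f x \<partial>M)"
proof (rule LIMSEQ_le_const)
  let ?H = "\<lambda>N. {x \<in> space M. \<exists>n\<le>N. birkhoff_sum f n x > 0}"
  let ?H' = "{x \<in> space M. \<exists>n. birkhoff_sum f n x > 0}"
  have [measurable]: "f \<in> borel_measurable M" using f by simp
  show "(\<lambda>N. \<integral>x. indicator (?H N) x * f x \<partial>M) \<longlonglongrightarrow> (\<integral>x. indicator ?H' x * f x \<partial>M)"
  proof (rule integral_dominated_convergence[where w = "\<lambda>x. \<bar>f x\<bar>"])
    show "AE x in M. (\<lambda>N. indicator (?H N) x * f x) \<longlonglongrightarrow> indicator ?H' x * f x"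
    proof (rule AE_I2)
      fix x assume x: "x \<in> space M"
      show "(\<lambda>N. indicator (?H N) x * f x) \<longlonglongrightarrow> indicator ?H' x * f x"
      proof (cases "x \<in> ?H'")
        case True
        then obtain n where n: "birkhoff_sum f n x > 0" by blast
        have "eventually (\<lambda>N. indicator (?H N) x * f x = indicator ?H' x * f x) sequentially"
          using eventually_ge_at_top[of n]
          by eventually_elim (use n x in \<open>auto simp: indicator_def\<close>)
        then show ?thesis by (rule tendsto_eventually)
      next
        case False
        then show ?thesis using x by auto
      qed
    qed
  qed (use f in \<open>auto simp: indicator_def\<close>)
  show "\<exists>N0. \<forall>N\<ge>N0. 0 \<le> (\<integral>x. indicator (?H N) x * f x \<partial>M)"
    using hopf_maximal_finite[OF f] by blast
qed

lemma birkhoff_sum_diff_const: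
  "birkhoff_sum (\<lambda>x. f x - c) n x = birkhoff_sum f n x - real n * (c :: real)"
  by (simp add: birkhoff_sum_def sum_subtractf)

lemma integral_indicator_minus_const:
  fixes f :: "'a \<Rightarrow> real"
  assumes f: "integrable M f" and E: "E \<in> sets M"
  shows "(\<integral>x. indicator E x * (f x - b) \<partial>M) = (\<integral>x. indicator E x * f x \<partial>M) - b * measure M E"
proof -
  have "integrable M (\<lambda>x. indicator E x * f x)"
    using integrable_mult_indicator[OF E f] by simp
  moreover have "integrable M (\<lambda>x. b * indicator E x)"
    using E by (intro integrable_mult_right integrable_real_indicator) (auto simp: emeasure_eq_measure)
  moreover have "(\<lambda>x. indicator E x * (f x - b)) = (\<lambda>x. indicator E x * f x - b * indicator E x)"
    by (simp add: algebra_simps)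
  ultimately show ?thesis
    using E sets.sets_into_space[OF E] by (simp add: Int_absorb2)
qed

text \<open>
  Hopf's inequality for \<open>f - t\<close>.
\<close>
theorem maximal_weak_type:
  fixes f :: "'a \<Rightarrow> real"
  assumes f: "integrable M f" and nonneg: "\<And>x. 0 \<le> f x"
  shows "ennreal t * emeasure M {x \<in> space M. \<exists>n. birkhoff_sum f n x > real n * t} \<le> (\<integral>\<^sup>+x. ennreal (f x) \<partial>M)"
proof (cases "t \<ge> 0")
  case True
  let ?H = "{x \<in> space M. \<exists>n. birkhoff_sum f n x > real n * t}"
  have [measurable]: "f \<in> borel_measurable M" using f by simp
  have H: "?H \<in> sets M" by measurable
  have "0 \<le> (\<integral>x. indicator ?H x * (f x - t) \<partial>M)"
    using hopf_maximal[of "\<lambda>x. f x - t"] f by (simp add: birkhoff_sum_diff_const)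
  also have "\<dots> = (\<integral>x. indicator ?H x * f x \<partial>M) - t * measure M ?H"
    by (rule integral_indicator_minus_const[OF f H])
  finally have "t * measure M ?H \<le> (\<integral>x. indicator ?H x * f x \<partial>M)" by simp
  also have "\<dots> \<le> (\<integral>x. f x \<partial>M)"
    using f nonneg integrable_mult_indicator[OF H f] by (intro integral_mono) (auto simp: indicator_def)
  finally have "ennreal (t * measure M ?H) \<le> ennreal (\<integral>x. f x \<partial>M)" by (rule ennreal_leI)
  then show ?thesis
    using True f nonneg by (simp add: nn_integral_eq_integral emeasure_eq_measure ennreal_mult)
next
  case False
  then show ?thesis by (simp add: ennreal_neg)
qed

text \<open>
  Hopf's inequality for the restriction of \<open>f - b\<close> to \<open>E\<close>: since \<open>E\<close> is invariant, the Birkhoff sums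
  of the restriction vanish off \<open>E\<close> and are those of \<open>f - b\<close> on \<open>E\<close>, so that the set where one of
  them is positive is exactly \<open>E\<close>.
\<close>
lemma invariant_set_mean_ge:
  fixes f :: "'a \<Rightarrow> real"
  assumes f: "integrable M f" and E: "E \<in> sets M"
    and inv: "\<And>x. x \<in> space M \<Longrightarrow> \<tau> x \<in> E \<longleftrightarrow> x \<in> E"
    and large: "\<And>x. x \<in> E \<Longrightarrow> \<exists>n. birkhoff_sum f n x > real n * b"
  shows "b * measure M E \<le> (\<integral>x. indicator E x * f x \<partial>M)"
proof -
  let ?g = "\<lambda>x. indicator E x * (f x - b)"
  have inv': "(\<tau> ^^ k) x \<in> E \<longleftrightarrow> x \<in> E" if "x \<in> space M" for x k
    using that by (induction k) (auto simp: inv funpow_in_space)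
  have sum: "birkhoff_sum ?g n x = indicator E x * (birkhoff_sum f n x - real n * b)" if "x \<in> space M" for n x
  proof -
    have "birkhoff_sum ?g n x = (\<Sum>k<n. indicator E x * (f ((\<tau> ^^ k) x) - b))"
      unfolding birkhoff_sum_def using inv'[OF that] by (intro sum.cong) (auto simp: indicator_def)
    also have "\<dots> = indicator E x * birkhoff_sum (\<lambda>x. f x - b) n x"
      by (simp add: birkhoff_sum_def sum_distrib_left)
    finally show ?thesis by (simp only: birkhoff_sum_diff_const)
  qed
  have ES: "E \<subseteq> space M" using E by (rule sets.sets_into_space)
  have "birkhoff_sum ?g n x > 0 \<longleftrightarrow> x \<in> E \<and> birkhoff_sum f n x > real n * b" if "x \<in> space M" for n x
    unfolding sum[OF that] by (simp add: indicator_def)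
  then have H: "{x \<in> space M. \<exists>n. birkhoff_sum ?g n x > 0} = E"
    using large ES by auto
  have "integrable M ?g"
    using integrable_mult_indicator[OF E, of "\<lambda>x. f x - b"] f by simp
  then have "0 \<le> (\<integral>x. indicator E x * ?g x \<partial>M)"
    using hopf_maximal[of ?g] by (simp only: H)
  also have "\<dots> = (\<integral>x. indicator E x * (f x - b) \<partial>M)"
    by (intro Bochner_Integration.integral_cong refl) (auto simp: indicator_def)
  also have "\<dots> = (\<integral>x. indicator E x * f x \<partial>M) - b * measure M E"
    by (rule integral_indicator_minus_const[OF f E])
  finally show ?thesis by simp
qed

text \<open>
  As \<open>f\<close> is bounded, the upper and lower limits \<open>u\<close> and \<open>l\<close> of the averages are invariant under \<open>\<tau>\<close>.
  For \<open>a < b\<close> the invariant set where \<open>l < a\<close> and \<open>b < u\<close> is null, because the mean of \<open>f\<close> over it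
  would be at least \<open>b\<close> and, by the same argument for \<open>- f\<close>, at most \<open>a\<close>.
\<close>
theorem birkhoff_bounded_real:
  fixes f :: "'a \<Rightarrow> real"
  assumes f [measurable]: "f \<in> borel_measurable M" and B: "\<And>x. \<bar>f x\<bar> \<le> B"
  shows "AE x in M. convergent (\<lambda>n. birkhoff_sum f n x / real n)"
proof -
  define A where "A n x = birkhoff_sum f n x / real n" for n x
  define u where "u x = limsup (\<lambda>n. ereal (A n x))" for x
  define l where "l x = liminf (\<lambda>n. ereal (A n x))" for x
  have [measurable]: "A n \<in> borel_measurable M" for n unfolding A_def by measurable
  have u_meas [measurable]: "u \<in> borel_measurable M" unfolding u_def by measurable
  have l_meas [measurable]: "l \<in> borel_measurable M" unfolding l_def by measurable
  have B0: "B \<ge> 0" using B[of undefined] by linarith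
  have sum_B: "\<bar>birkhoff_sum f n x\<bar> \<le> real n * B" for n x
    unfolding birkhoff_sum_def using sum_bounded_above[of "{..<n}" "\<lambda>k. \<bar>f ((\<tau> ^^ k) x)\<bar>" B] B
    by (intro order_trans[OF sum_abs]) simp
  have A_B: "\<bar>A n x\<bar> \<le> B" for n x
    using sum_B[of n x] B0 by (cases "n = 0") (auto simp: A_def field_simps)
  have diff: "(\<lambda>n. A n (\<tau> x) - A n x) \<longlonglongrightarrow> 0" for x
  proof (rule tendsto_0_le[where K = "1" and f = "\<lambda>n. 2 * B / real n"])
    show "(\<lambda>n. 2 * B / real n) \<longlonglongrightarrow> 0"
      by (intro tendsto_divide_0[OF tendsto_const] filterlim_at_top_imp_at_infinity filterlim_real_sequentially)
    show "\<forall>\<^sub>F n in sequentially. norm (A n (\<tau> x) - A n x) \<le> norm (2 * B / real n) * 1"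
    proof (rule always_eventually, rule allI)
      fix n
      have "f x + birkhoff_sum f n (\<tau> x) = birkhoff_sum f n x + f ((\<tau> ^^ n) x)"
        unfolding birkhoff_sum_Suc[symmetric] by (simp add: birkhoff_sum_def)
      then have "birkhoff_sum f n (\<tau> x) - birkhoff_sum f n x = f ((\<tau> ^^ n) x) - f x" by simp
      then have "\<bar>birkhoff_sum f n (\<tau> x) - birkhoff_sum f n x\<bar> \<le> 2 * B"
        using B[of "(\<tau> ^^ n) x"] B[of x] by linarith
      then show "norm (A n (\<tau> x) - A n x) \<le> norm (2 * B / real n) * 1"
        using B0 by (simp add: A_def diff_divide_distrib[symmetric] divide_right_mono)
    qed
  qed
  have u_inv: "u (\<tau> x) = u x" and l_inv: "l (\<tau> x) = l x" for x
  proof -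
    have "(\<lambda>n. ereal (A n (\<tau> x) - A n x)) \<longlonglongrightarrow> 0"
      using diff[of x] by (simp add: zero_ereal_def)
    then have "limsup (\<lambda>n. ereal (A n (\<tau> x) - A n x) + ereal (A n x)) = 0 + u x"
      "liminf (\<lambda>n. ereal (A n (\<tau> x) - A n x) + ereal (A n x)) = 0 + l x"
      unfolding u_def l_def by (intro ereal_limsup_lim_add ereal_liminf_lim_add; simp)+
    then show "u (\<tau> x) = u x" "l (\<tau> x) = l x" by (simp_all add: u_def l_def)
  qed
  have f_int: "integrable M f"
    by (rule integrable_const_bound[of _ B]) (use B in auto)
  have u_large: "\<exists>n\<ge>1. A n x > b" if "ereal b < u x" for x b
  proof (rule ccontr)
    assume "\<not> (\<exists>n\<ge>1. A n x > b)"
    then have "eventually (\<lambda>n. ereal (A n x) \<le> ereal b) sequentially"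
      by (intro eventually_sequentiallyI[of 1]) (auto simp: not_less)
    then have "u x \<le> ereal b" unfolding u_def by (rule Limsup_bounded)
    then show False using that by auto
  qed
  have l_small: "\<exists>n\<ge>1. A n x < a" if "l x < ereal a" for x a
  proof (rule ccontr)
    assume "\<not> (\<exists>n\<ge>1. A n x < a)"
    then have "eventually (\<lambda>n. ereal a \<le> ereal (A n x)) sequentially"
      by (intro eventually_sequentiallyI[of 1]) (auto simp: not_less)
    then have "ereal a \<le> l x" unfolding l_def by (rule Liminf_bounded)
    then show False using that by auto
  qed
  have null: "AE x in M. \<not> (l x < ereal a \<and> ereal b < u x)" if ab: "a < b" for a b
  proof -
    let ?E = "{x \<in> space M. l x < ereal a \<and> ereal b < u x}"
    have E: "?E \<in> sets M" by measurable
    have inv: "\<tau> x \<in> ?E \<longleftrightarrow> x \<in> ?E" if "x \<in> space M" for x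
      using that u_inv l_inv funpow_in_space[of x 1] by simp
    have "b * measure M ?E \<le> (\<integral>x. indicator ?E x * f x \<partial>M)"
    proof (rule invariant_set_mean_ge[OF f_int E inv])
      fix x assume x: "x \<in> ?E"
      then obtain n where "n \<ge> 1" "A n x > b" using u_large by blast
      then show "\<exists>n. birkhoff_sum f n x > real n * b"
        by (intro exI[of _ n]) (simp add: A_def field_simps)
    qed
    moreover have "- a * measure M ?E \<le> (\<integral>x. indicator ?E x * - f x \<partial>M)"
    proof (rule invariant_set_mean_ge[OF _ E inv])
      show "integrable M (\<lambda>x. - f x)" using f_int by simp
      fix x assume x: "x \<in> ?E"
      then obtain n where "n \<ge> 1" "A n x < a" using l_small by blast
      then show "\<exists>n. birkhoff_sum (\<lambda>x. - f x) n x > real n * - a"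
        by (intro exI[of _ n]) (simp add: A_def birkhoff_sum_def sum_negf field_simps)
    qed
    ultimately have "b * measure M ?E \<le> a * measure M ?E" by simp
    then have "measure M ?E = 0"
      using ab measure_nonneg[of M ?E] by (simp add: mult_le_cancel_right)
    then show ?thesis using E by (subst AE_iff_measurable[OF E]) (auto simp: emeasure_eq_measure)
  qed
  have "AE x in M. \<forall>a\<in>\<rat>. \<forall>b\<in>\<rat>. a < b \<longrightarrow> \<not> (l x < ereal a \<and> ereal b < u x)"
    using null by (intro AE_ball_countable[THEN iffD2] countable_rat ballI AE_impI)  auto
  then show ?thesis
  proof (rule AE_mp, intro AE_I2 impI)
    fix x assume *: "\<forall>a\<in>\<rat>. \<forall>b\<in>\<rat>. a < b \<longrightarrow> \<not> (l x < ereal a \<and> ereal b < u x)"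
    have "u x \<le> ereal B" unfolding u_def using A_B by (intro Limsup_bounded always_eventually) (auto simp: abs_le_iff)
    moreover have "ereal (- B) \<le> l x" unfolding l_def using A_B by (intro Liminf_bounded always_eventually) (auto simp: abs_le_iff minus_le_iff)
    moreover have lu: "l x \<le> u x" unfolding l_def u_def by (rule Liminf_le_Limsup) simp
    ultimately obtain u' l' where ul: "u x = ereal u'" "l x = ereal l'"
      by (cases "u x"; cases "l x") auto
    have "u' \<le> l'"
    proof (rule ccontr)
      assume "\<not> u' \<le> l'"
      then obtain a where a: "a \<in> \<rat>" "l' < a" "a < u'" using Rats_dense_in_real[of l' u'] by auto
      then obtain b where "b \<in> \<rat>" "a < b" "b < u'" using Rats_dense_in_real[of a u'] by auto
      then show False using * a ul by auto
    qed
    then have "(\<lambda>n. A n x) \<longlonglongrightarrow> u'"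
      using ul by (intro limsup_le_liminf_real) (auto simp: u_def l_def)
    then show "convergent (\<lambda>n. birkhoff_sum f n x / real n)"
      unfolding A_def by (rule convergentI)
  qed
qed

end

section \<open>The dominated ergodic theorem\<close>

lemma nn_integral_powr_from_0:
  assumes a: "a > 0" and y: "y \<ge> 0"
  shows "(\<integral>\<^sup>+t. ennreal (t powr (a - 1)) * indicator {0<..<y} t \<partial>lborel) = ennreal (y powr a / a)"
proof -
  have "((\<lambda>t. t powr (a - 1)) has_integral (y powr (a - 1 + 1) / (a - 1 + 1))) {0..y}"
    using a y by (intro has_integral_powr_from_0) auto
  then have "((\<lambda>t. indicator {0..y} t * t powr (a - 1)) has_integral (y powr a / a)) UNIV"
    by (subst (asm) has_integral_restrict_UNIV[symmetric])
      (auto elim!: has_integral_eq_rhs[OF has_integral_eq[rotated]] simp: indicator_def)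
  then have "(\<integral>\<^sup>+t. ennreal (indicator {0..y} t * t powr (a - 1)) \<partial>lborel) = ennreal (y powr a / a)"
    by (intro nn_integral_has_integral_lborel) auto
  moreover have "(\<integral>\<^sup>+t. ennreal (t powr (a - 1)) * indicator {0<..<y} t \<partial>lborel) =
      (\<integral>\<^sup>+t. ennreal (indicator {0..y} t * t powr (a - 1)) \<partial>lborel)"
    using AE_lborel_singleton[of 0] AE_lborel_singleton[of y]
    by (intro nn_integral_cong_AE) (auto simp: indicator_def)
  ultimately show ?thesis by simp
qed

text \<open>
  Marcinkiewicz interpolation. Write \<open>G\<^sup>q\<close> as the integral of \<open>2\<^sup>q q t\<^sup>q\<^sup>-\<^sup>1\<close> over \<open>0 < t < G / 2\<close>, exchange
  the integrals, and apply the weak inequality at each level. It involves only the part of \<open>F\<close> above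
  \<open>t\<close>, so exchanging back leaves \<open>F\<close> times the integral of a multiple of \<open>t\<^sup>q\<^sup>-\<^sup>2\<close> over \<open>0 < t < F\<close>,
  which is finite as \<open>q > 1\<close>.
\<close>
lemma strong_type_from_weak_type:
  assumes "sigma_finite_measure M" and q: "q > 1"
    and F [measurable]: "F \<in> borel_measurable M" and F0: "\<And>x. 0 \<le> F x"
    and G [measurable]: "G \<in> borel_measurable M" and G0: "\<And>x. 0 \<le> G x"
    and weak: "\<And>t. t > 0 \<Longrightarrow> ennreal t * emeasure M {x \<in> space M. G x > 2 * t} \<le>
        (\<integral>\<^sup>+x. ennreal (F x) * indicator {t<..} (F x) \<partial>M)"
  shows "(\<integral>\<^sup>+x. ennreal (G x powr q) \<partial>M) \<le>
      ennreal (2 powr q * q / (q - 1)) * (\<integral>\<^sup>+x. ennreal (F x powr q) \<partial>M)"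
proof -
  interpret sigma_finite_measure M by fact
  interpret pair_sigma_finite lborel M
    by (intro pair_sigma_finite.intro sigma_finite_lborel sigma_finite_measure_axioms)
  define c where "c = 2 powr q * q"
  have c0: "c \<ge> 0" using q by (simp add: c_def)
  have "(\<integral>\<^sup>+x. ennreal (G x powr q) \<partial>M) =
      (\<integral>\<^sup>+x. \<integral>\<^sup>+t. ennreal c * ennreal (t powr (q - 1)) * indicator {0<..<G x / 2} t \<partial>lborel \<partial>M)"
  proof (rule nn_integral_cong)
    fix x
    have "(\<integral>\<^sup>+t. ennreal c * ennreal (t powr (q - 1)) * indicator {0<..<G x / 2} t \<partial>lborel) =
        ennreal c * (\<integral>\<^sup>+t. ennreal (t powr (q - 1)) * indicator {0<..<G x / 2} t \<partial>lborel)"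
      unfolding mult.assoc by (intro nn_integral_cmult) auto
    also have "\<dots> = ennreal (c * ((G x / 2) powr q / q))"
      using q c0 G0[of x] by (subst nn_integral_powr_from_0) (auto simp: ennreal_mult'[symmetric])
    also have "c * ((G x / 2) powr q / q) = G x powr q"
      using q G0[of x] by (simp add: c_def powr_divide)
    finally show "ennreal (G x powr q) =
        (\<integral>\<^sup>+t. ennreal c * ennreal (t powr (q - 1)) * indicator {0<..<G x / 2} t \<partial>lborel)" by simp
  qed
  also have "\<dots> = (\<integral>\<^sup>+t. \<integral>\<^sup>+x. ennreal c * ennreal (t powr (q - 1)) * indicator {0<..<G x / 2} t \<partial>M \<partial>lborel)"
  proof (rule Fubini')
    have "(\<lambda>(t, x). ennreal c * ennreal (t powr (q - 1)) * (if 0 < t \<and> t < G x / 2 then 1 else 0))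
        \<in> borel_measurable (lborel \<Otimes>\<^sub>M M)" by measurable
    then show "(\<lambda>(t, x). ennreal c * ennreal (t powr (q - 1)) * indicator {0<..<G x / 2} t)
        \<in> borel_measurable (lborel \<Otimes>\<^sub>M M)" by (simp add: indicator_def of_bool_def)
  qed
  also have "\<dots> \<le> (\<integral>\<^sup>+t. \<integral>\<^sup>+x. ennreal c * ennreal (t powr (q - 1 - 1)) * ennreal (F x) * indicator {0<..<F x} t \<partial>M \<partial>lborel)"
  proof (rule nn_integral_mono)
    fix t :: real
    show "(\<integral>\<^sup>+x. ennreal c * ennreal (t powr (q - 1)) * indicator {0<..<G x / 2} t \<partial>M) \<le>
        (\<integral>\<^sup>+x. ennreal c * ennreal (t powr (q - 1 - 1)) * ennreal (F x) * indicator {0<..<F x} t \<partial>M)"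
    proof (cases "t > 0")
      case True
      have "(\<integral>\<^sup>+x. ennreal c * ennreal (t powr (q - 1)) * indicator {0<..<G x / 2} t \<partial>M) =
          (\<integral>\<^sup>+x. ennreal c * ennreal (t powr (q - 1)) * indicator {x \<in> space M. G x > 2 * t} x \<partial>M)"
        using True by (intro nn_integral_cong) (auto simp: indicator_def)
      also have "\<dots> = ennreal c * ennreal (t powr (q - 1)) * emeasure M {x \<in> space M. G x > 2 * t}"
        by (rule nn_integral_cmult_indicator) measurable
      also have "\<dots> = ennreal c * ennreal (t powr (q - 1 - 1)) * (ennreal t * emeasure M {x \<in> space M. G x > 2 * t})"
      proof -
        have "t powr (q - 1) = t powr (q - 1 - 1) * t"
          using True powr_add[of t "q - 1 - 1" 1] by simp
        then show ?thesis using True by (simp add: ennreal_mult mult.assoc)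
      qed
      also have "\<dots> \<le> ennreal c * ennreal (t powr (q - 1 - 1)) * (\<integral>\<^sup>+x. ennreal (F x) * indicator {t<..} (F x) \<partial>M)"
        by (intro mult_left_mono weak True) auto
      also have "\<dots> = (\<integral>\<^sup>+x. ennreal c * ennreal (t powr (q - 1 - 1)) * (ennreal (F x) * indicator {t<..} (F x)) \<partial>M)"
        by (rule nn_integral_cmult[symmetric]) measurable
      also have "\<dots> = (\<integral>\<^sup>+x. ennreal c * ennreal (t powr (q - 1 - 1)) * ennreal (F x) * indicator {0<..<F x} t \<partial>M)"
        using True by (intro nn_integral_cong) (auto simp: indicator_def)
      finally show ?thesis .
    qed simp
  qed
  also have "\<dots> = (\<integral>\<^sup>+x. \<integral>\<^sup>+t. ennreal c * ennreal (t powr (q - 1 - 1)) * ennreal (F x) * indicator {0<..<F x} t \<partial>lborel \<partial>M)"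
  proof (rule Fubini'[symmetric])
    have "(\<lambda>(t, x). ennreal c * ennreal (t powr (q - 1 - 1)) * ennreal (F x) * (if 0 < t \<and> t < F x then 1 else 0))
        \<in> borel_measurable (lborel \<Otimes>\<^sub>M M)" by measurable
    then show "(\<lambda>(t, x). ennreal c * ennreal (t powr (q - 1 - 1)) * ennreal (F x) * indicator {0<..<F x} t)
        \<in> borel_measurable (lborel \<Otimes>\<^sub>M M)" by (simp add: indicator_def of_bool_def)
  qed
  also have "\<dots> = (\<integral>\<^sup>+x. ennreal (c / (q - 1)) * ennreal (F x powr q) \<partial>M)"
  proof (rule nn_integral_cong)
    fix x
    have "(\<integral>\<^sup>+t. ennreal c * ennreal (t powr (q - 1 - 1)) * ennreal (F x) * indicator {0<..<F x} t \<partial>lborel) =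
        (\<integral>\<^sup>+t. ennreal c * ennreal (F x) * (ennreal (t powr (q - 1 - 1)) * indicator {0<..<F x} t) \<partial>lborel)"
      by (simp add: mult_ac)
    also have "\<dots> = ennreal c * ennreal (F x) * (\<integral>\<^sup>+t. ennreal (t powr (q - 1 - 1)) * indicator {0<..<F x} t \<partial>lborel)"
      by (intro nn_integral_cmult) auto
    also have "\<dots> = ennreal (c * F x * (F x powr (q - 1) / (q - 1)))"
      using q c0 F0[of x] by (subst nn_integral_powr_from_0) (auto simp: ennreal_mult'[symmetric])
    also have "c * F x * (F x powr (q - 1) / (q - 1)) = c / (q - 1) * F x powr q"
    proof -
      have "F x * F x powr (q - 1) = F x powr q"
        using F0[of x] powr_add[of "F x" 1 "q - 1"] by (cases "F x = 0") auto
      then show ?thesis by (simp add: mult_ac)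
    qed
    also have "ennreal (c / (q - 1) * F x powr q) = ennreal (c / (q - 1)) * ennreal (F x powr q)"
      using c0 q by (intro ennreal_mult) auto
    finally show "(\<integral>\<^sup>+t. ennreal c * ennreal (t powr (q - 1 - 1)) * ennreal (F x) * indicator {0<..<F x} t \<partial>lborel) =
        ennreal (c / (q - 1)) * ennreal (F x powr q)" .
  qed
  also have "\<dots> = ennreal (c / (q - 1)) * (\<integral>\<^sup>+x. ennreal (F x powr q) \<partial>M)"
    by (rule nn_integral_cmult) measurable
  finally show ?thesis by (simp add: c_def)
qed

context dynamical_system
begin

text \<open>
  \<open>G\<close> stands for a maximum of finitely many ergodic averages of \<open>F\<close>; for such maxima everything stays
  real-valued. The part of \<open>F\<close> up to height \<open>t\<close> adds at most \<open>t\<close> to an average, so if an average of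
  \<open>F\<close> exceeds \<open>2 t\<close>, then one of the part above \<open>t\<close> exceeds \<open>t\<close>, and the weak-type inequality applies
  to that part.
\<close>
lemma dominated_ergodic:
  fixes F G :: "'a \<Rightarrow> real"
  assumes q: "q > 1"
    and F [measurable]: "F \<in> borel_measurable M" and F0: "\<And>x. 0 \<le> F x"
    and G [measurable]: "G \<in> borel_measurable M" and G0: "\<And>x. 0 \<le> G x"
    and GF: "\<And>x t. x \<in> space M \<Longrightarrow> t < G x \<Longrightarrow> t > 0 \<Longrightarrow> \<exists>n\<ge>1. (\<Sum>k=1..n. F ((\<tau> ^^ k) x)) > real n * t"
  shows "(\<integral>\<^sup>+x. ennreal (G x powr q) \<partial>M) \<le>
      ennreal (2 powr q * q / (q - 1)) * (\<integral>\<^sup>+x. ennreal (F x powr q) \<partial>M)"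
proof (cases "(\<integral>\<^sup>+x. ennreal (F x powr q) \<partial>M) = \<infinity>")
  case True
  have "2 powr q * q / (q - 1) > 0" using q by simp
  then have "ennreal (2 powr q * q / (q - 1)) * \<infinity> = \<infinity>"
    using q by (simp add: ennreal_mult_top ennreal_eq_0_iff not_le)
  then show ?thesis unfolding True by simp
next
  case False
  have "integrable M (\<lambda>x. F x powr q)"
    using False by (intro integrableI_nonneg) (auto simp: less_top)
  then have "integrable M (\<lambda>x. 1 + F x powr q)" by simp
  \<comment> \<open>\<open>F \<le> 1 + F powr q\<close>, and the measure is finite.\<close>
  then have F_int: "integrable M F"
  proof (rule Bochner_Integration.integrable_bound)
    show "AE x in M. norm (F x) \<le> norm (1 + F x powr q)"
    proof (rule AE_I2)
      fix x
      have "F x \<le> 1 + F x powr q"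
      proof (cases "F x \<le> 1")
        case False
        then have "F x powr 1 \<le> F x powr q" using q by (intro powr_mono) auto
        then show ?thesis using False by simp
      qed (simp add: add_increasing2)
      then show "norm (F x) \<le> norm (1 + F x powr q)" using F0[of x] by simp
    qed
  qed measurable
  show ?thesis
  proof (rule strong_type_from_weak_type[OF sigma_finite_measure_axioms q F F0 G G0])
    fix t :: real assume t: "t > 0"
    let ?f = "\<lambda>x. F x * indicator {t<..} (F x)"
    let ?H = "{x \<in> space M. \<exists>n. birkhoff_sum ?f n x > real n * t}"
    have f_int: "integrable M ?f"
      by (rule Bochner_Integration.integrable_bound[OF F_int]) (auto simp: indicator_def)
    have [measurable]: "?f \<in> borel_measurable M" by measurable
    have H: "?H \<in> sets M" by measurable
    have sub: "{x \<in> space M. G x > 2 * t} \<subseteq> {x \<in> space M. \<tau> x \<in> ?H}"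
    proof safe
      fix x assume x: "x \<in> space M" "G x > 2 * t"
      show "\<tau> x \<in> space M" using funpow_in_space[of x 1] x by simp
      obtain n where n: "n \<ge> 1" "(\<Sum>k=1..n. F ((\<tau> ^^ k) x)) > real n * (2 * t)"
        using GF[OF x] t by auto
      have "(\<Sum>k=1..n. F ((\<tau> ^^ k) x)) \<le> (\<Sum>k=1..n. ?f ((\<tau> ^^ k) x) + t)"
        using t by (intro sum_mono) (auto simp: indicator_def)
      also have "\<dots> = birkhoff_sum ?f n (\<tau> x) + real n * t"
        by (simp add: birkhoff_sum_map sum.distrib)
      finally show "\<exists>n. real n * t < birkhoff_sum ?f n (\<tau> x)"
        using n by (intro exI[of _ n]) simp
    qed
    have "emeasure M {x \<in> space M. G x > 2 * t} \<le> emeasure M ?H"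
      unfolding emeasure_map[OF H, symmetric]
    proof (rule emeasure_mono[OF sub])
      show "{x \<in> space M. \<tau> x \<in> ?H} \<in> sets M"
        using measurable_sets[OF measurable_map H] by (simp add: vimage_def Int_def conj_commute)
    qed
    then have "ennreal t * emeasure M {x \<in> space M. G x > 2 * t} \<le> ennreal t * emeasure M ?H"
      by (intro mult_left_mono) auto
    also have "\<dots> \<le> (\<integral>\<^sup>+x. ennreal (?f x) \<partial>M)"
      using F0 by (intro maximal_weak_type f_int) auto
    also have "\<dots> = (\<integral>\<^sup>+x. ennreal (F x) * indicator {t<..} (F x) \<partial>M)"
      by (intro nn_integral_cong) (auto simp: indicator_def)
    finally show "ennreal t * emeasure M {x \<in> space M. G x > 2 * t} \<le> \<dots>" .
  qed
qed

end

section \<open>Weighted averages\<close>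

lemma ennreal_powr_ennreal: "0 \<le> x \<Longrightarrow> ennreal_powr (ennreal x) r = ennreal (x powr r)"
  by (simp add: ennreal_powr_def)

lemma ennreal_powr_mono: "x \<le> y \<Longrightarrow> 0 < r \<Longrightarrow> ennreal_powr x r \<le> ennreal_powr y r"
  unfolding ennreal_powr_def
  by (cases x; cases y) (auto simp: top_unique intro!: ennreal_leI powr_mono2)

lemma ennreal_powr_inverse: "0 < r \<Longrightarrow> ennreal_powr (ennreal_powr x r) (1 / r) = x"
  unfolding ennreal_powr_def by (cases x) (auto simp: powr_powr)

lemma ennreal_powr_inverse': "0 < r \<Longrightarrow> ennreal_powr (ennreal_powr x (1 / r)) r = x"
  unfolding ennreal_powr_def by (cases x) (auto simp: powr_powr)

text \<open>
  By this adjunction a power of a supremum is bounded as soon as the powers are.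
\<close>
lemma ennreal_powr_le_iff: "0 < r \<Longrightarrow> ennreal_powr x r \<le> y \<longleftrightarrow> x \<le> ennreal_powr y (1 / r)"
  using ennreal_powr_mono[of "ennreal_powr x r" y "1 / r"] ennreal_powr_mono[of x "ennreal_powr y (1 / r)" r]
  by (auto simp: ennreal_powr_inverse ennreal_powr_inverse')

lemma ennreal_powr_mult:
  "0 < r \<Longrightarrow> 0 \<le> c \<Longrightarrow> ennreal_powr (ennreal c * y) r \<le> ennreal (c powr r) * ennreal_powr y r"
  unfolding ennreal_powr_def
  by (cases y; cases "c = 0") (auto simp: ennreal_mult_top ennreal_mult[symmetric] powr_mult)

lemma ennreal_powr_eq_top_iff: "ennreal_powr x r = \<infinity> \<longleftrightarrow> x = \<infinity>"
  by (simp add: ennreal_powr_def)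

lemma ennreal_powr_eq_0_iff: "0 < r \<Longrightarrow> ennreal_powr x r = 0 \<longleftrightarrow> x = 0"
  unfolding ennreal_powr_def by (cases x) auto

lemma ennreal_powr_measurable [measurable]:
  assumes [measurable]: "f \<in> borel_measurable M"
  shows "(\<lambda>x. ennreal_powr (f x) r) \<in> borel_measurable M"
  unfolding ennreal_powr_def by measurable

text \<open>
  Hoelder's inequality for the exponents \<open>r\<close> and \<open>s\<close>, in the form of Young's inequality for
  \<open>\<bar>w k\<bar> / m\<close> and \<open>b k / A\<close>, where \<open>m\<close> is the mean weight and \<open>A\<close> the power mean of \<open>b\<close>. The
  normalised powers sum to at most \<open>K n\<close> and \<open>n\<close>, which explains the constant \<open>K + 1\<close>.
\<close>
lemma weighted_average_le_power_mean:
  fixes w :: "nat \<Rightarrow> real" and r :: nat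
  assumes r: "r \<ge> 2" and K: "K \<ge> 0" and n: "n \<ge> 1"
    and bd: "(\<Sum>k=1..n. \<bar>w k\<bar> ^ r) \<le> K * real n * (total_weight w n / real n) ^ r"
  defines "s \<equiv> real r / (real r - 1)"
  shows "cmod (weighted_average w \<tau> f n x) \<le>
      (K + 1) * ((\<Sum>k=1..n. cmod (f ((\<tau> ^^ k) x)) powr s) / real n) powr (1 / s)"
proof -
  define W where "W = total_weight w n"
  define b where "b k = cmod (f ((\<tau> ^^ k) x))" for k
  define v where "v = (\<Sum>k=1..n. b k powr s) / real n"
  define A where "A = v powr (1 / s)"
  have W0: "W \<ge> 0" by (simp add: W_def total_weight_def sum_nonneg)
  have s: "s > 1" and rs: "1 / real r + 1 / s = 1" using r by (auto simp: s_def field_simps)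
  have v0: "v \<ge> 0" unfolding v_def by (intro divide_nonneg_nonneg sum_nonneg) auto
  have A0: "A \<ge> 0" by (simp add: A_def)
  have As: "A powr s = (\<Sum>k=1..n. b k powr s) / real n"
    unfolding v_def[symmetric] A_def using s v0 by (simp add: powr_powr)
  have *: "(\<Sum>k=1..n. \<bar>w k\<bar> * b k) \<le> (K + 1) * A * W" if Wpos: "W > 0"
  proof (cases "A = 0")
    case True
    then have "(\<Sum>k=1..n. b k powr s) = 0" using As n s by simp
    then have "\<forall>k\<in>{1..n}. b k powr s = 0" by (subst (asm) sum_nonneg_eq_0_iff) auto
    then have "\<forall>k\<in>{1..n}. b k = 0" by auto
    then show ?thesis using True by simp
  next
    case False
    then have Apos: "A > 0" using A0 by simp
    define m where "m = W / real n"
    have mpos: "m > 0" using Wpos n by (simp add: m_def)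
    have "(\<Sum>k=1..n. \<bar>w k\<bar> / m * (b k / A)) \<le> (\<Sum>k=1..n. (\<bar>w k\<bar> / m) ^ r + (b k / A) powr s)"
    proof (rule sum_mono)
      fix k
      have a: "\<bar>w k\<bar> / m \<ge> 0" and c: "b k / A \<ge> 0" using mpos Apos by (auto simp: b_def)
      have "\<bar>w k\<bar> / m * (b k / A) \<le> (\<bar>w k\<bar> / m) powr real r / real r + (b k / A) powr s / s"
        using r s rs a c by (intro Youngs_inequality) auto
      also have "\<dots> \<le> (\<bar>w k\<bar> / m) powr real r / 1 + (b k / A) powr s / 1"
        using r s by (intro add_mono divide_left_mono) auto
      also have "(\<bar>w k\<bar> / m) powr real r = (\<bar>w k\<bar> / m) ^ r"
        using a r by (intro powr_realpow') auto
      finally show "\<bar>w k\<bar> / m * (b k / A) \<le> (\<bar>w k\<bar> / m) ^ r + (b k / A) powr s" by simp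
    qed
    also have "\<dots> = (\<Sum>k=1..n. \<bar>w k\<bar> ^ r) / m ^ r + (\<Sum>k=1..n. b k powr s) / A powr s"
      using Apos by (simp add: sum.distrib power_divide powr_divide b_def sum_divide_distrib)
    also have "\<dots> \<le> K * real n + real n"
    proof (rule add_mono)
      show "(\<Sum>k=1..n. \<bar>w k\<bar> ^ r) / m ^ r \<le> K * real n"
        using bd mpos by (simp add: divide_le_eq m_def W_def)
      have "(\<Sum>k=1..n. b k powr s) = real n * A powr s" using As n by simp
      then show "(\<Sum>k=1..n. b k powr s) / A powr s \<le> real n" using Apos by simp
    qed
    finally have "(\<Sum>k=1..n. \<bar>w k\<bar> * b k) / (m * A) \<le> (K + 1) * real n"
      by (simp add: sum_divide_distrib algebra_simps)
    then have "(\<Sum>k=1..n. \<bar>w k\<bar> * b k) \<le> (K + 1) * real n * (m * A)"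
      using mpos Apos by (simp add: divide_le_eq)
    also have "\<dots> = (K + 1) * A * W" using n by (simp add: m_def)
    finally show ?thesis .
  qed
  show ?thesis
  proof (cases "W = 0")
    case True
    then show ?thesis using K by (simp add: weighted_average_def W_def)
  next
    case False
    then have Wpos: "W > 0" using W0 by simp
    have "cmod (\<Sum>k=1..n. complex_of_real (w k) * f ((\<tau> ^^ k) x)) \<le> (\<Sum>k=1..n. \<bar>w k\<bar> * b k)"
      by (rule order_trans[OF norm_sum]) (simp add: norm_mult b_def)
    also have "\<dots> \<le> (K + 1) * A * W" by (rule *[OF Wpos])
    finally show ?thesis
      using Wpos by (simp add: weighted_average_def W_def[symmetric] norm_divide divide_le_eq A_def v_def b_def)
  qed
qed

lemma cmod_weighted_average_le_maximal_function:
  "n \<ge> 1 \<Longrightarrow> ennreal (cmod (weighted_average w \<tau> f n x)) \<le> maximal_function w \<tau> f x"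
  unfolding maximal_function_def by (rule SUP_upper) simp

lemma Lp_norm_finite_iff:
  "p > 0 \<Longrightarrow> Lp_norm p M f < \<infinity> \<longleftrightarrow> (\<integral>\<^sup>+x. ennreal_powr (ennreal (cmod (f x))) p \<partial>M) < \<infinity>"
  unfolding Lp_norm_def Lp_enorm_def less_top[symmetric] infinity_ennreal_def
  using ennreal_powr_eq_top_iff by simp

context dynamical_system
begin

lemma weighted_average_measurable [measurable]:
  assumes "f \<in> borel_measurable M"
  shows "weighted_average w \<tau> f n \<in> borel_measurable M"
proof -
  have [measurable]: "(\<lambda>x. f ((\<tau> ^^ k) x)) \<in> borel_measurable M" for k
    by (rule measurable_iterate[OF assms])
  show ?thesis unfolding weighted_average_def by measurable
qed

lemma maximal_function_measurable [measurable]: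
  assumes [measurable]: "f \<in> borel_measurable M"
  shows "maximal_function w \<tau> f \<in> borel_measurable M"
  unfolding maximal_function_def by measurable

text \<open>
  The dominated ergodic theorem for \<open>F = \<bar>f\<bar>\<^sup>s\<close>, with \<open>s\<close> conjugate to \<open>r\<close>, in the exponent
  \<open>q = p / s > 1\<close>. It is applied to the maxima \<open>G N\<close> over \<open>n \<le> N + 1\<close>, which increase with \<open>N\<close>, and
  monotone convergence yields the full supremum.
\<close>
lemma weighted_maximal_inequality:
  fixes w :: "nat \<Rightarrow> real" and r :: nat and f :: "'a \<Rightarrow> complex"
  assumes r: "r \<ge> 2" and K: "K \<ge> 0"
    and bd: "\<And>n. n \<ge> 1 \<Longrightarrow> (\<Sum>k=1..n. \<bar>w k\<bar> ^ r) \<le> K * real n * (total_weight w n / real n) ^ r"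
    and p: "p > real r / (real r - 1)" and f [measurable]: "f \<in> borel_measurable M"
  defines "q \<equiv> p * (real r - 1) / real r"
  shows "(\<integral>\<^sup>+x. ennreal_powr (maximal_function w \<tau> f x) p \<partial>M) \<le>
      ennreal ((K + 1) powr p * (2 powr q * q / (q - 1))) * (\<integral>\<^sup>+x. ennreal_powr (ennreal (cmod (f x))) p \<partial>M)"
proof -
  define s where "s = real r / (real r - 1)"
  have s: "s > 1" using r by (auto simp: s_def field_simps)
  have qs: "q = p / s" using r by (simp add: q_def s_def)
  have q: "q > 1" using p[folded s_def] s by (simp add: qs)
  have p0: "p > 0" using p s by (simp add: s_def)
  define F where "F x = cmod (f x) powr s" for x
  define avg where "avg n x = (\<Sum>k=1..n. F ((\<tau> ^^ k) x)) / real n" for n x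
  define G where "G N x = Max ((\<lambda>n. avg n x) ` {1..Suc N})" for N x
  have F_meas [measurable]: "F \<in> borel_measurable M" unfolding F_def by measurable
  have F0: "F x \<ge> 0" for x by (simp add: F_def)
  have [measurable]: "(\<lambda>x. F ((\<tau> ^^ k) x)) \<in> borel_measurable M" for k
    by (rule measurable_iterate[OF F_meas])
  have [measurable]: "avg n \<in> borel_measurable M" for n unfolding avg_def by measurable
  have G_meas [measurable]: "G N \<in> borel_measurable M" for N
    unfolding G_def by (rule borel_measurable_Max) auto
  have avg_le_G: "avg n x \<le> G N x" if "n \<in> {1..Suc N}" for n N x
    unfolding G_def using that by (intro Max_ge) auto
  have avg0: "avg n x \<ge> 0" for n x unfolding avg_def using F0 by (intro divide_nonneg_nonneg sum_nonneg) auto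
  have G0: "G N x \<ge> 0" for N x using avg_le_G[of 1 N x] avg0[of 1 x] by simp
  have G_attained: "\<exists>n\<in>{1..Suc N}. G N x = avg n x" for N x
  proof -
    have "G N x \<in> (\<lambda>n. avg n x) ` {1..Suc N}" unfolding G_def by (intro Max_in) auto
    then show ?thesis by blast
  qed
  define Y where "Y N x = ennreal ((K + 1) powr p) * ennreal (G N x powr q)" for N x
  have Y_meas: "Y N \<in> borel_measurable M" for N
    unfolding Y_def by measurable
  have Y_mono: "incseq Y"
  proof (intro incseq_SucI le_funI)
    fix N x
    have "G N x \<le> G (Suc N) x" unfolding G_def by (intro Max_mono) auto
    then show "Y N x \<le> Y (Suc N) x"
      unfolding Y_def using q G0 by (intro mult_left_mono ennreal_leI powr_mono2) auto
  qed
  have "ennreal_powr (maximal_function w \<tau> f x) p \<le> (SUP N. Y N x)" for x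
    unfolding ennreal_powr_le_iff[OF p0] maximal_function_def
  proof (rule SUP_least)
    fix n :: nat assume n: "n \<in> {1..}"
    have "cmod (weighted_average w \<tau> f n x) powr p \<le> ((K + 1) * avg n x powr (1 / s)) powr p"
      using weighted_average_le_power_mean[OF r K _ bd, of n \<tau> f x] n p0
      by (intro powr_mono2) (auto simp: avg_def F_def s_def)
    also have "\<dots> = (K + 1) powr p * avg n x powr q"
      using K avg0 by (simp add: powr_mult powr_powr qs)
    also have "\<dots> \<le> (K + 1) powr p * G (n - 1) x powr q"
      using avg_le_G[of n "n - 1" x] n q avg0 by (intro mult_left_mono powr_mono2) auto
    finally have "ennreal_powr (ennreal (cmod (weighted_average w \<tau> f n x))) p \<le> Y (n - 1) x"
      by (simp add: ennreal_powr_ennreal Y_def ennreal_mult[symmetric] ennreal_leI)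
    also have "\<dots> \<le> (SUP N. Y N x)" by (rule SUP_upper) simp
    finally show "ennreal (cmod (weighted_average w \<tau> f n x)) \<le> ennreal_powr (SUP N. Y N x) (1 / p)"
      unfolding ennreal_powr_le_iff[OF p0] .
  qed
  then have "(\<integral>\<^sup>+x. ennreal_powr (maximal_function w \<tau> f x) p \<partial>M) \<le> (\<integral>\<^sup>+x. (SUP N. Y N x) \<partial>M)"
    by (intro nn_integral_mono)
  also have "\<dots> = (SUP N. \<integral>\<^sup>+x. Y N x \<partial>M)"
    by (rule nn_integral_monotone_convergence_SUP[OF Y_mono Y_meas])
  also have "\<dots> \<le> ennreal ((K + 1) powr p * (2 powr q * q / (q - 1))) * (\<integral>\<^sup>+x. ennreal (F x powr q) \<partial>M)"
  proof (rule SUP_least)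
    fix N
    have "(\<integral>\<^sup>+x. ennreal (G N x powr q) \<partial>M) \<le>
        ennreal (2 powr q * q / (q - 1)) * (\<integral>\<^sup>+x. ennreal (F x powr q) \<partial>M)"
    proof (rule dominated_ergodic[OF q F_meas F0 G_meas G0])
      fix x t assume t: "t < G N x"
      obtain n where n: "n \<in> {1..Suc N}" "G N x = avg n x" using G_attained by blast
      then have "t < avg n x" using t by simp
      then show "\<exists>n\<ge>1. (\<Sum>k=1..n. F ((\<tau> ^^ k) x)) > real n * t"
        using n(1) by (intro exI[of _ n]) (simp add: avg_def less_divide_eq mult.commute)
    qed
    then have "ennreal ((K + 1) powr p) * (\<integral>\<^sup>+x. ennreal (G N x powr q) \<partial>M) \<le>
        ennreal ((K + 1) powr p) * (ennreal (2 powr q * q / (q - 1)) * (\<integral>\<^sup>+x. ennreal (F x powr q) \<partial>M))"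
      by (intro mult_left_mono) auto
    then show "(\<integral>\<^sup>+x. Y N x \<partial>M) \<le>
        ennreal ((K + 1) powr p * (2 powr q * q / (q - 1))) * (\<integral>\<^sup>+x. ennreal (F x powr q) \<partial>M)"
      unfolding ennreal_mult'[OF powr_ge_zero] mult.assoc Y_def by (subst nn_integral_cmult) measurable
  qed
  also have "(\<lambda>x. ennreal (F x powr q)) = (\<lambda>x. ennreal_powr (ennreal (cmod (f x))) p)"
    using s by (simp add: F_def powr_powr qs ennreal_powr_ennreal)
  finally show ?thesis .
qed

lemma bounded_average_convergent:
  fixes f :: "'a \<Rightarrow> complex"
  assumes f [measurable]: "f \<in> borel_measurable M" and B: "\<And>x. cmod (f x) \<le> B"
  shows "AE x in M. convergent (\<lambda>n. (\<Sum>k=1..n. f ((\<tau> ^^ k) x)) / of_nat n)"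
proof -
  have "AE x in M. convergent (\<lambda>n. birkhoff_sum (\<lambda>x. Re (f x)) n x / real n)"
    using B abs_Re_le_cmod order_trans by (intro birkhoff_bounded_real[of _ B]) (measurable, blast)
  moreover have "AE x in M. convergent (\<lambda>n. birkhoff_sum (\<lambda>x. Im (f x)) n x / real n)"
    using B abs_Im_le_cmod order_trans by (intro birkhoff_bounded_real[of _ B]) (measurable, blast)
  ultimately have "AE x in M. convergent (\<lambda>n. birkhoff_sum (\<lambda>x. Re (f x)) n x / real n) \<and>
      convergent (\<lambda>n. birkhoff_sum (\<lambda>x. Im (f x)) n x / real n)"
    by eventually_elim auto
  then have "AE x in M. convergent (\<lambda>n. birkhoff_sum (\<lambda>x. Re (f x)) n (\<tau> x) / real n) \<and>
      convergent (\<lambda>n. birkhoff_sum (\<lambda>x. Im (f x)) n (\<tau> x) / real n)"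
    by (rule AE_map)
  then show ?thesis
  proof eventually_elim
    case (elim x)
    then obtain a b where
      "(\<lambda>n. (\<Sum>k=1..n. Re (f ((\<tau> ^^ k) x))) / real n) \<longlonglongrightarrow> a"
      "(\<lambda>n. (\<Sum>k=1..n. Im (f ((\<tau> ^^ k) x))) / real n) \<longlonglongrightarrow> b"
      unfolding birkhoff_sum_map convergent_def by blast
    then have "(\<lambda>n. Complex ((\<Sum>k=1..n. Re (f ((\<tau> ^^ k) x))) / real n)
        ((\<Sum>k=1..n. Im (f ((\<tau> ^^ k) x))) / real n)) \<longlonglongrightarrow> Complex a b"
      by (rule tendsto_Complex)
    moreover have "Complex ((\<Sum>k=1..n. Re (f ((\<tau> ^^ k) x))) / real n)
        ((\<Sum>k=1..n. Im (f ((\<tau> ^^ k) x))) / real n) = (\<Sum>k=1..n. f ((\<tau> ^^ k) x)) / of_nat n" for n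
      by (simp add: complex_eq_iff)
    ultimately show ?case by (simp add: convergent_def) blast
  qed
qed

text \<open>
  Replacing the weights \<open>w k\<close>, \<open>k \<le> n\<close>, by the constant \<open>c n\<close> changes the weighted average by a null
  sequence \<open>E\<close>, as \<open>f\<close> is bounded. What remains is the unweighted average \<open>a n\<close> times
  \<open>\<rho> n = n c n / W n\<close>, and \<open>\<rho>\<close> tends to \<open>1\<close> by the same hypothesis.
\<close>
lemma bounded_weighted_average_convergent:
  fixes f :: "'a \<Rightarrow> complex" and w c :: "nat \<Rightarrow> real"
  assumes w0: "\<And>k. 0 \<le> w k" and W: "filterlim (total_weight w) at_top sequentially"
    and dev: "(\<lambda>n. (\<Sum>k=1..n. \<bar>w k - c n\<bar>) / total_weight w n) \<longlonglongrightarrow> 0"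
    and f: "f \<in> borel_measurable M" and B: "\<And>x. cmod (f x) \<le> B"
  shows "AE x in M. convergent (\<lambda>n. weighted_average w \<tau> f n x)"
  using bounded_average_convergent[OF f B]
proof eventually_elim
  case (elim x)
  let ?W = "total_weight w"
  define a where "a n = (\<Sum>k=1..n. f ((\<tau> ^^ k) x)) / of_nat n" for n
  define E where "E n = (\<Sum>k=1..n. complex_of_real (w k - c n) * f ((\<tau> ^^ k) x)) / complex_of_real (?W n)" for n
  define \<rho> where "\<rho> n = real n * c n / ?W n" for n
  obtain l where l: "a \<longlonglongrightarrow> l" using elim unfolding a_def convergent_def by blast
  have W0: "?W n \<ge> 0" for n by (simp add: total_weight_def sum_nonneg)
  have "E \<longlonglongrightarrow> 0"
  proof (rule tendsto_0_le[OF dev])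
    show "\<forall>\<^sub>F n in sequentially. norm (E n) \<le> norm ((\<Sum>k=1..n. \<bar>w k - c n\<bar>) / ?W n) * B"
    proof (rule always_eventually, rule allI)
      fix n
      have "cmod (\<Sum>k=1..n. complex_of_real (w k - c n) * f ((\<tau> ^^ k) x)) \<le> (\<Sum>k=1..n. \<bar>w k - c n\<bar> * B)"
        using B by (intro order_trans[OF norm_sum] sum_mono) (simp add: norm_mult mult_left_mono flip: of_real_diff)
      also have "\<dots> = (\<Sum>k=1..n. \<bar>w k - c n\<bar>) * B" by (simp add: sum_distrib_right)
      finally show "norm (E n) \<le> norm ((\<Sum>k=1..n. \<bar>w k - c n\<bar>) / ?W n) * B"
        using W0[of n] by (simp add: E_def norm_divide divide_right_mono sum_nonneg abs_of_nonneg)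
    qed
  qed
  moreover have "\<rho> \<longlonglongrightarrow> 1"
  proof -
    have "(\<lambda>n. \<rho> n - 1) \<longlonglongrightarrow> 0"
    proof (rule tendsto_0_le[OF dev, where K = 1])
      show "\<forall>\<^sub>F n in sequentially. norm (\<rho> n - 1) \<le> norm ((\<Sum>k=1..n. \<bar>w k - c n\<bar>) / ?W n) * 1"
        using filterlim_at_top_dense[THEN iffD1, OF W, THEN spec, of 0]
      proof eventually_elim
        case (elim n)
        have "?W n = (\<Sum>k=1..n. w k)" using w0 by (simp add: total_weight_def)
        then have "\<rho> n - 1 = - (\<Sum>k=1..n. w k - c n) / ?W n"
          using elim by (simp add: \<rho>_def sum_subtractf field_simps)
        then show ?case
          using elim sum_abs[of "\<lambda>k. w k - c n" "{1..n}"] by (simp add: sum_nonneg divide_right_mono)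
      qed
    qed
    then show ?thesis by (simp add: LIM_zero_iff)
  qed
  then have "(\<lambda>n. complex_of_real (\<rho> n)) \<longlonglongrightarrow> complex_of_real 1" by (rule tendsto_of_real)
  ultimately have "(\<lambda>n. E n + complex_of_real (\<rho> n) * a n) \<longlonglongrightarrow> 0 + complex_of_real 1 * l"
    by (intro tendsto_add tendsto_mult l)
  moreover have "weighted_average w \<tau> f n x = E n + complex_of_real (\<rho> n) * a n" for n
  proof -
    have "(\<Sum>k=1..n. complex_of_real (w k) * f ((\<tau> ^^ k) x)) =
        (\<Sum>k=1..n. complex_of_real (w k - c n) * f ((\<tau> ^^ k) x)) + complex_of_real (c n) * (\<Sum>k=1..n. f ((\<tau> ^^ k) x))"
      by (simp add: sum_distrib_left sum.distrib[symmetric] algebra_simps)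
    then show ?thesis
      by (cases "n = 0") (simp_all add: weighted_average_def E_def \<rho>_def a_def add_divide_distrib)
  qed
  ultimately show ?case by (auto simp: convergent_def)
qed

text \<open>
  Banach's principle. Split \<open>f\<close> at height \<open>j\<close>. The averages of \<open>f\<close> differ from the convergent averages
  of the bounded part \<open>low j\<close> by at most the maximal function \<open>e j\<close> of \<open>high j\<close>. The norms of \<open>e j\<close>
  tend to \<open>0\<close> by the dominated inequality, so almost everywhere some \<open>e j\<close> is as small as desired and
  the averages of \<open>f\<close> form a Cauchy sequence.
\<close>
lemma convergent_of_bounded_convergent:
  fixes f :: "'a \<Rightarrow> complex"
  assumes p: "p > 0" and C: "C > 0" and f: "f \<in> Lp_space p M"
    and dom: "\<And>h. h \<in> Lp_space p M \<Longrightarrow> Lp_enorm p M (maximal_function w \<tau> h) \<le> ennreal C * Lp_norm p M h"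
    and bounded: "\<And>h B. h \<in> borel_measurable M \<Longrightarrow> (\<And>x. cmod (h x) \<le> B) \<Longrightarrow>
        AE x in M. convergent (\<lambda>n. weighted_average w \<tau> h n x)"
  shows "AE x in M. convergent (\<lambda>n. weighted_average w \<tau> f n x)"
proof -
  have f_meas [measurable]: "f \<in> borel_measurable M" using f by (simp add: Lp_space_def)
  let ?P = "\<lambda>h x. ennreal_powr (ennreal (cmod (h x))) p"
  have f_fin: "(\<integral>\<^sup>+x. ?P f x \<partial>M) < \<infinity>"
    using f Lp_norm_finite_iff[OF p, of M f] by (simp add: Lp_space_def)
  define low where "low j x = (if cmod (f x) \<le> real j then f x else 0)" for j :: nat and x
  define high where "high j x = (if cmod (f x) \<le> real j then 0 else f x)" for j :: nat and x
  have low_meas [measurable]: "low j \<in> borel_measurable M" for j unfolding low_def by measurable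
  have high_meas [measurable]: "high j \<in> borel_measurable M" for j unfolding high_def by measurable
  have P_high: "?P (high j) x \<le> ?P f x" for j x
    using p by (intro ennreal_powr_mono) (auto simp: high_def)
  have high_fin: "(\<integral>\<^sup>+x. ?P (high j) x \<partial>M) < \<infinity>" for j
    by (rule le_less_trans[OF nn_integral_mono f_fin]) (rule P_high)
  then have high_Lp: "high j \<in> Lp_space p M" for j
    using Lp_norm_finite_iff[OF p, of M "high j"] by (simp add: Lp_space_def)
  have "(\<lambda>j. \<integral>\<^sup>+x. ?P (high j) x \<partial>M) \<longlonglongrightarrow> (\<integral>\<^sup>+x. 0 \<partial>M)"
  proof (rule nn_integral_dominated_convergence[where w = "?P f"])
    show "AE x in M. (\<lambda>j. ?P (high j) x) \<longlonglongrightarrow> 0"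
    proof (rule AE_I2, rule tendsto_eventually)
      fix x
      obtain j0 :: nat where "cmod (f x) \<le> real j0" using real_arch_simple by blast
      then show "eventually (\<lambda>j. ?P (high j) x = 0) sequentially"
        using p by (intro eventually_sequentiallyI[of j0]) (auto simp: high_def ennreal_powr_def)
    qed
  qed (use f_fin P_high in \<open>auto simp: less_top\<close>)
  then have high_0: "(\<lambda>j. \<integral>\<^sup>+x. ?P (high j) x \<partial>M) \<longlonglongrightarrow> 0" by simp
  define e where "e j = maximal_function w \<tau> (high j)" for j
  have [measurable]: "e j \<in> borel_measurable M" for j unfolding e_def by measurable
  have e_le: "(\<integral>\<^sup>+x. ennreal_powr (e j x) p \<partial>M) \<le> ennreal (C powr p) * (\<integral>\<^sup>+x. ?P (high j) x \<partial>M)" for j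
  proof -
    have "ennreal_powr (\<integral>\<^sup>+x. ennreal_powr (e j x) p \<partial>M) (1 / p) \<le>
        ennreal C * ennreal_powr (\<integral>\<^sup>+x. ?P (high j) x \<partial>M) (1 / p)"
      using dom[OF high_Lp[of j]] by (simp add: Lp_norm_def Lp_enorm_def e_def)
    then have "ennreal_powr (ennreal_powr (\<integral>\<^sup>+x. ennreal_powr (e j x) p \<partial>M) (1 / p)) p \<le>
        ennreal_powr (ennreal C * ennreal_powr (\<integral>\<^sup>+x. ?P (high j) x \<partial>M) (1 / p)) p"
      using p by (rule ennreal_powr_mono)
    also have "\<dots> \<le> ennreal (C powr p) * ennreal_powr (ennreal_powr (\<integral>\<^sup>+x. ?P (high j) x \<partial>M) (1 / p)) p"
      using p C by (intro ennreal_powr_mult) auto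
    finally show ?thesis using p by (simp add: ennreal_powr_inverse')
  qed
  define I where "I x = (INF j. e j x)" for x
  have [measurable]: "I \<in> borel_measurable M" unfolding I_def by measurable
  have "(\<integral>\<^sup>+x. ennreal_powr (I x) p \<partial>M) \<le> 0"
  proof (rule LIMSEQ_le_const)
    show "(\<lambda>j. ennreal (C powr p) * (\<integral>\<^sup>+x. ?P (high j) x \<partial>M)) \<longlonglongrightarrow> 0"
      using ennreal_tendsto_cmult[OF _ high_0, of "ennreal (C powr p)"] by simp
    have "(\<integral>\<^sup>+x. ennreal_powr (I x) p \<partial>M) \<le> (\<integral>\<^sup>+x. ennreal_powr (e j x) p \<partial>M)" for j
      unfolding I_def using p by (intro nn_integral_mono ennreal_powr_mono INF_lower) auto
    then show "\<exists>N. \<forall>j\<ge>N. (\<integral>\<^sup>+x. ennreal_powr (I x) p \<partial>M) \<le> ennreal (C powr p) * (\<integral>\<^sup>+x. ?P (high j) x \<partial>M)"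
      using e_le order_trans by blast
  qed
  then have "AE x in M. ennreal_powr (I x) p = 0"
    by (subst nn_integral_0_iff_AE[symmetric]) auto
  moreover have "AE x in M. \<forall>j. convergent (\<lambda>n. weighted_average w \<tau> (low j) n x)"
    unfolding AE_all_countable
  proof
    fix j
    show "AE x in M. convergent (\<lambda>n. weighted_average w \<tau> (low j) n x)"
      by (rule bounded[of _ "real j"]) (auto simp: low_def)
  qed
  ultimately show ?thesis
  proof eventually_elim
    case (elim x)
    have I0: "I x = 0" using elim(1) p by (simp add: ennreal_powr_eq_0_iff)
    have "Cauchy (\<lambda>n. weighted_average w \<tau> f n x)"
    proof (rule metric_CauchyI)
      fix \<epsilon> :: real assume \<epsilon>: "\<epsilon> > 0"
      have "(INF j. e j x) < ennreal (\<epsilon> / 3)" using I0 \<epsilon> by (simp add: I_def)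
      then obtain j where j: "e j x < ennreal (\<epsilon> / 3)" by (auto simp: INF_less_iff)
      have close: "dist (weighted_average w \<tau> f n x) (weighted_average w \<tau> (low j) n x) < \<epsilon> / 3" if "n \<ge> 1" for n
      proof -
        have "f y - low j y = high j y" for y by (simp add: low_def high_def)
        then have "weighted_average w \<tau> f n x - weighted_average w \<tau> (low j) n x = weighted_average w \<tau> (high j) n x"
          by (simp add: weighted_average_def diff_divide_distrib[symmetric] sum_subtractf[symmetric] right_diff_distrib[symmetric])
        moreover have "ennreal (cmod (weighted_average w \<tau> (high j) n x)) < ennreal (\<epsilon> / 3)"
          using cmod_weighted_average_le_maximal_function[OF that] j unfolding e_def by (rule le_less_trans)
        ultimately show ?thesis by (simp add: dist_norm ennreal_less_iff)
      qed
      have "Cauchy (\<lambda>n. weighted_average w \<tau> (low j) n x)"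
        using elim(2) by (simp add: convergent_Cauchy)
      then obtain N where N: "\<And>m n. m \<ge> N \<Longrightarrow> n \<ge> N \<Longrightarrow>
          dist (weighted_average w \<tau> (low j) m x) (weighted_average w \<tau> (low j) n x) < \<epsilon> / 3"
        using metric_CauchyD[of _ "\<epsilon> / 3"] \<epsilon> by (metis divide_pos_pos zero_less_numeral)
      have "dist (weighted_average w \<tau> f m x) (weighted_average w \<tau> f n x) < \<epsilon>"
        if "m \<ge> max 1 N" "n \<ge> max 1 N" for m n
        using close[of m] close[of n] N[of m n] that dist_triangle_third
        by (metis dist_commute max.bounded_iff)
      then show "\<exists>N. \<forall>m\<ge>N. \<forall>n\<ge>N. dist (weighted_average w \<tau> f m x) (weighted_average w \<tau> f n x) < \<epsilon>"
        by blast
    qed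
    then show ?case by (rule Cauchy_convergent)
  qed
qed

end

section \<open>Good weights\<close>

lemma ex_dominated_with_of_moments:
  fixes w :: "nat \<Rightarrow> real" and r :: nat
  assumes r: "r \<ge> 2" and K: "K \<ge> 0"
    and bd: "\<And>n. n \<ge> 1 \<Longrightarrow> (\<Sum>k=1..n. \<bar>w k\<bar> ^ r) \<le> K * real n * (total_weight w n / real n) ^ r"
    and p: "p > real r / (real r - 1)"
  shows "\<exists>C>0. dominated_with TYPE('a) w p C"
proof -
  define q where "q = p * (real r - 1) / real r"
  define D where "D = (K + 1) powr p * (2 powr q * q / (q - 1))"
  have "p > 1" using p r by (auto simp: less_divide_eq intro: le_less_trans[rotated])
  moreover have "q > 1" using p r by (simp add: q_def field_simps)
  ultimately have p0: "p > 0" and D: "D > 0" using K by (auto simp: D_def)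
  have "Lp_enorm p M (maximal_function w \<tau> f) \<le> ennreal (D powr (1 / p)) * Lp_norm p M f"
    if "dynamical_system M \<tau>" "f \<in> Lp_space p M" for M :: "'a measure" and \<tau> f
  proof -
    interpret dynamical_system M \<tau> by fact
    have "(\<integral>\<^sup>+x. ennreal_powr (maximal_function w \<tau> f x) p \<partial>M) \<le>
        ennreal D * (\<integral>\<^sup>+x. ennreal_powr (ennreal (cmod (f x))) p \<partial>M)"
      unfolding D_def q_def using that(2)
      by (intro weighted_maximal_inequality[OF r K bd p]) (auto simp: Lp_space_def)
    then have "Lp_enorm p M (maximal_function w \<tau> f) \<le>
        ennreal_powr (ennreal D * (\<integral>\<^sup>+x. ennreal_powr (ennreal (cmod (f x))) p \<partial>M)) (1 / p)"
      unfolding Lp_enorm_def using p0 by (intro ennreal_powr_mono) auto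
    also have "\<dots> \<le> ennreal (D powr (1 / p)) * Lp_norm p M f"
      unfolding Lp_norm_def Lp_enorm_def using p0 D by (intro ennreal_powr_mult) auto
    finally show ?thesis .
  qed
  then show ?thesis
    using D by (intro exI[of _ "D powr (1 / p)"]) (auto simp: dominated_with_def)
qed

text \<open>
  The orbit map \<open>\<phi> x = (f (\<tau>\<^sup>k x))\<^sub>k\<close> intertwines \<open>\<tau>\<close> with the shift on sequences, and \<open>f\<close> is the
  zeroth coordinate composed with \<open>\<phi>\<close>. For the image measure, the norms of the coordinate and of its
  maximal function are therefore those of \<open>f\<close> and of its maximal function.
\<close>
lemma dominated_with_transfer:
  assumes dom: "dominated_with TYPE(nat \<Rightarrow> complex) w p C"
  shows "dominated_with TYPE('a) w p C"
  unfolding dominated_with_def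
proof (intro allI impI ballI)
  fix M :: "'a measure" and \<tau> f
  assume "dynamical_system M \<tau>" and f: "f \<in> Lp_space p M"
  interpret dynamical_system M \<tau> by fact
  define P where "P = (\<Pi>\<^sub>M k\<in>(UNIV :: nat set). (borel :: complex measure))"
  define shift :: "(nat \<Rightarrow> complex) \<Rightarrow> nat \<Rightarrow> complex" where "shift \<omega> = (\<lambda>n. \<omega> (Suc n))" for \<omega>
  define \<phi> where "\<phi> x = (\<lambda>k. f ((\<tau> ^^ k) x))" for x
  define N where "N = distr M P \<phi>"
  have f_meas [measurable]: "f \<in> borel_measurable M" using f by (simp add: Lp_space_def)
  have \<phi> [measurable]: "\<phi> \<in> measurable M P"
    unfolding P_def \<phi>_def using measurable_iterate[OF f_meas]
    by (intro measurable_PiM_single') (auto simp: space_PiM)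
  have coord [measurable]: "(\<lambda>\<omega>. \<omega> n) \<in> borel_measurable P" for n
    unfolding P_def by (rule measurable_component_singleton) simp
  have shift [measurable]: "shift \<in> measurable P P"
    unfolding shift_def using coord unfolding P_def
    by (intro measurable_PiM_single') (auto simp: space_PiM)
  have N_P: "sets N = sets P" by (simp add: N_def)
  have meas_N: "measurable N L = measurable P L" for L :: "'c measure"
    by (rule measurable_cong_sets) (auto simp: N_P)
  have shift_\<phi>: "shift (\<phi> x) = \<phi> (\<tau> x)" for x
    by (simp add: shift_def \<phi>_def funpow_swap1)
  have N_ds: "dynamical_system N shift"
  proof (intro dynamical_system.intro dynamical_system_axioms.intro)
    show "prob_space N" unfolding N_def by (rule prob_space_distr) measurable
    show "shift \<in> measurable N N" using shift by (subst measurable_cong_sets[OF N_P N_P])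
    have "distr N N shift = distr N P shift" by (rule distr_cong) (auto simp: N_P)
    also have "\<dots> = distr M P (shift \<circ> \<phi>)" unfolding N_def by (rule distr_distr) measurable
    also have "shift \<circ> \<phi> = \<phi> \<circ> \<tau>" by (auto simp: shift_\<phi>)
    also have "distr M P (\<phi> \<circ> \<tau>) = distr (distr M M \<tau>) P \<phi>"
      by (rule distr_distr[OF \<phi> measurable_map, symmetric])
    also have "\<dots> = N" by (simp add: preserves_measure N_def)
    finally show "distr N N shift = N" .
  qed
  interpret N: dynamical_system N shift by (rule N_ds)
  have norm_N: "Lp_enorm p N h = Lp_enorm p M (\<lambda>x. h (\<phi> x))" if h: "h \<in> borel_measurable N" for h
  proof -
    have [measurable]: "h \<in> borel_measurable P" using h by (simp add: meas_N)
    show ?thesis unfolding Lp_enorm_def N_def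
      by (subst nn_integral_distr[OF \<phi>]) auto
  qed
  let ?e = "\<lambda>\<omega> :: nat \<Rightarrow> complex. \<omega> 0"
  have e_meas: "?e \<in> borel_measurable N" using coord by (simp add: meas_N)
  have shift_pow: "(shift ^^ k) \<omega> n = \<omega> (n + k)" for k \<omega> n
    by (induction k arbitrary: n) (auto simp: shift_def)
  have "Lp_norm p N ?e = Lp_norm p M f"
    unfolding Lp_norm_def by (subst norm_N) (use e_meas in \<open>auto simp: \<phi>_def\<close>)
  moreover have "Lp_enorm p N (maximal_function w shift ?e) = Lp_enorm p M (maximal_function w \<tau> f)"
  proof -
    have "maximal_function w shift ?e (\<phi> x) = maximal_function w \<tau> f x" for x
      by (simp add: maximal_function_def weighted_average_def shift_pow \<phi>_def)
    then show ?thesis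
      by (subst norm_N[OF N.maximal_function_measurable[OF e_meas]]) simp
  qed
  moreover have "Lp_enorm p N (maximal_function w shift ?e) \<le> ennreal C * Lp_norm p N ?e"
  proof -
    have "?e \<in> Lp_space p N"
      using e_meas f \<open>Lp_norm p N ?e = Lp_norm p M f\<close> by (simp add: Lp_space_def)
    then show ?thesis using dom N_ds unfolding dominated_with_def by blast
  qed
  ultimately show "Lp_enorm p M (maximal_function w \<tau> f) \<le> ennreal C * Lp_norm p M f" by simp
qed

text \<open>
  The maximal inequality gives the dominated theorem for the systems on each type separately, and
  \<open>dominated_with_transfer\<close> makes the constant independent of the type. By the same inequality,
  pointwise convergence extends from bounded functions to \<open>L\<^sup>p\<close>.
\<close>
theorem good_weight_criterion:
  fixes w c :: "nat \<Rightarrow> real" and r :: nat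
  assumes w0: "\<And>k. 0 \<le> w k" and W: "filterlim (total_weight w) at_top sequentially"
    and r: "r \<ge> 2" and K: "K \<ge> 0"
    and bd: "\<And>n. n \<ge> 1 \<Longrightarrow> (\<Sum>k=1..n. w k ^ r) \<le> K * real n * (total_weight w n / real n) ^ r"
    and p: "p > real r / (real r - 1)"
    and dev: "(\<lambda>n. (\<Sum>k=1..n. \<bar>w k - c n\<bar>) / total_weight w n) \<longlonglongrightarrow> 0"
  shows "good_weight_dominated TYPE('a) w p" and "good_weight_pointwise TYPE('a) w p"
proof -
  have bd': "(\<Sum>k=1..n. \<bar>w k\<bar> ^ r) \<le> K * real n * (total_weight w n / real n) ^ r" if "n \<ge> 1" for n
    using bd[OF that] w0 by simp
  have "0 < real r / (real r - 1)" using r by simp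
  then have p0: "p > 0" using p by linarith
  show "good_weight_dominated TYPE('a) w p"
    unfolding good_weight_dominated_def
    using W ex_dominated_with_of_moments[OF r K bd' p] dominated_with_transfer by blast
  obtain C where C: "C > 0" "dominated_with TYPE('a) w p C"
    using ex_dominated_with_of_moments[OF r K bd' p] by blast
  show "good_weight_pointwise TYPE('a) w p"
    unfolding good_weight_pointwise_def
  proof (intro conjI W allI impI ballI)
    fix M :: "'a measure" and \<tau> f
    assume ds: "dynamical_system M \<tau>" and f: "f \<in> Lp_space p M"
    interpret dynamical_system M \<tau> by fact
    show "AE x in M. convergent (\<lambda>n. weighted_average w \<tau> f n x)"
    proof (rule convergent_of_bounded_convergent[OF p0 C(1) f])
      show "Lp_enorm p M (maximal_function w \<tau> h) \<le> ennreal C * Lp_norm p M h" if "h \<in> Lp_space p M" for h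
        using C(2) ds that by (simp add: dominated_with_def)
    qed (rule bounded_weighted_average_convergent[OF w0 W dev])
  qed
qed

theorem theorem2p6:
  fixes g :: "nat \<Rightarrow> nat" and p :: real
  assumes "additive_function g"
    and "\<And>q. prime q \<Longrightarrow> g q = 1"
    and "\<exists>\<beta>>0. \<forall>m\<ge>1. \<forall>q::nat. prime q \<longrightarrow> real (g (q ^ m)) \<le> \<beta> * real m * ln (real q)"
    and "p > 1"
  shows "good_weight_dominated TYPE('a) (\<lambda>n. real (g n)) p \<and>
         good_weight_pointwise TYPE('a) (\<lambda>n. real (g n)) p"
proof -
  \<comment> \<open>The conjugate exponent of \<open>r\<close> is below \<open>p\<close> once \<open>r\<close> exceeds the conjugate exponent of \<open>p\<close>.\<close>
  obtain r0 where "real r0 > max 2 (p / (p - 1))" using reals_Archimedean2 by blast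
  then obtain r where "r \<ge> 2" and "real r > p / (p - 1)" by (intro that[of r0]) auto
  then have r: "r \<ge> 2" "p > real r / (real r - 1)" using assms(4) by (auto simp: field_simps)
  then obtain K where "K \<ge> 0"
    and "\<And>n. (\<Sum>k=1..n. real (g k) ^ r) \<le> K * real n * (total_weight (\<lambda>n. real (g n)) n / real n) ^ r"
    using additive_weight_estimates(2)[OF assms(1-3), of r] by auto
  then show ?thesis
    using good_weight_criterion[OF _ additive_weight_estimates(1)[OF assms(1-3)] r(1) _ _ r(2)
        additive_weight_estimates(3)[OF assms(1-3)], of K]
    by simp
qed

end
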